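(* Let $\Bbbk$ be a field of characteristic different from $2$, let $V$ be a $\Bbbk$-vector space of finite odd dimension $n$ with ordered basis $(x_1,\dots,x_n)$, and let $A=\bigwedge^*V$ be its exterior algebra, which is a symmetric Frobenius algebra with respect to the bilinear form $\langle a,b\rangle=\int(a\wedge b)$. The cohomology class $\mathfrak{Div}(A)$ in $H^1(\mathrm{HH}^1(A),Z(A))$ is not trivial.
   Context: $\int:A\to\Bbbk$ is the linear form vanishing on $\bigwedge^iV$ for $0\le i\le n-1$ with $\int(x_1\wedge\cdots\wedge x_n)=1$. Since $n$ is odd, the form $\langle a,b\rangle=\int(a\wedge b)$ is symmetric; it is also non-degenerate and associative ($\langle ab,c\rangle=\langle a,bc\rangle$). The Nakayama divergence of a derivation $\delta:A\to A$ is the unique element $\mathrm{div}_\sigma(\delta)\in A$ such that $\langle\delta(a),b\rangle+\langle a,\delta(b)\rangle=\langle a,b\cdot\mathrm{div}_\sigma(\delta)\rangle$ for all $a,b\in A$. $Z(A)$ is the center of $A$; $\mathrm{HH}^1(A)=\mathrm{Der}(A)/\mathrm{InnDer}(A)$ is the Lie algebra of outer derivations of $A$, which acts on $Z(A)$ by evaluating derivations. As the form is symmetric, $\mathrm{div}_\sigma$ takes values in $Z(A)$, vanishes on inner derivations, and induces a Lie algebra (Chevalley–Eilenberg) $1$-cocycle $\mathrm{HH}^1(A)\to Z(A)$, whose class in the Lie algebra cohomology $H^1(\mathrm{HH}^1(A),Z(A))$ is $\mathfrak{Div}(A)$. (A $1$-cocycle $f:\mathfrak g\to M$ is a coboundary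 if there is $m\in M$ with $f(x)=x\cdot m$ for all $x\in\mathfrak g$.) *)

theory Defs
  imports
    "HOL-Algebra.Module"
    "HOL-Algebra.QuotRing"
    "HOL-Algebra.Algebraic_Closure_Type"
    "HOL-Library.Poly_Mapping"
    "HOL-Library.FuncSet"
begin

section \<open>Linear maps, quotients and Lie algebras\<close>

text \<open>
  The ground field is a type of class \<open>field\<close>.  Vector spaces and algebras that arise as
  subquotients are \<open>module\<close> records (an algebra uses the fields \<open>mult\<close> and \<open>one\<close>, a mere vector
  space leaves them \<open>undefined\<close>).  Maps between carriers are extensional, so that equality of
  maps is equality on the carrier.
\<close>

definition linear_maps ::
    "('k, 'a, 'c) module_scheme \<Rightarrow> ('k, 'b, 'd) module_scheme \<Rightarrow> ('a \<Rightarrow> 'b) set" where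
  "linear_maps M N =
    {f \<in> carrier M \<rightarrow>\<^sub>E carrier N.
       (\<forall>u\<in>carrier M. \<forall>v\<in>carrier M. f (u \<oplus>\<^bsub>M\<^esub> v) = f u \<oplus>\<^bsub>N\<^esub> f v) \<and>
       (\<forall>c. \<forall>u\<in>carrier M. f (c \<odot>\<^bsub>M\<^esub> u) = c \<odot>\<^bsub>N\<^esub> f u)}"

definition quotient_space ::
    "('k, 'a, 'c) module_scheme \<Rightarrow> 'a set \<Rightarrow> ('k, 'a set) module" where
  "quotient_space M N =
    \<lparr>carrier = a_rcosets\<^bsub>M\<^esub> N, monoid.mult = undefined, one = undefined, zero = N, add = set_add M,
     module.smult = (\<lambda>c S. \<Union>u\<in>S. N +>\<^bsub>M\<^esub> (c \<odot>\<^bsub>M\<^esub> u))\<rparr>"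

definition ground_field :: "('k::field, 'k) module" where
  "ground_field =
    \<lparr>carrier = UNIV, monoid.mult = (*), one = 1, zero = 0, add = (+), module.smult = (*)\<rparr>"

record ('k, 'g) lie_algebra = "('k, 'g) module" +
  lie_bracket :: "'g \<Rightarrow> 'g \<Rightarrow> 'g"

definition quotient_lie_algebra ::
    "('k, 'g, 'c) lie_algebra_scheme \<Rightarrow> 'g set \<Rightarrow> ('k, 'g set) lie_algebra" where
  "quotient_lie_algebra L I =
    module.extend (quotient_space L I)
      \<lparr>lie_bracket = (\<lambda>S T. \<Union>x\<in>S. \<Union>y\<in>T. I +>\<^bsub>L\<^esub> lie_bracket L x y)\<rparr>"


section \<open>Chevalley--Eilenberg cohomology in degree one\<close>

text \<open>The action of the Lie algebra \<open>L\<close> on the module \<open>M\<close> is the function \<open>act\<close>.\<close>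

definition CE_cocycles1 ::
    "('k, 'g, 'c) lie_algebra_scheme \<Rightarrow> ('k, 'm, 'd) module_scheme \<Rightarrow> ('g \<Rightarrow> 'm \<Rightarrow> 'm)
      \<Rightarrow> ('k, 'g \<Rightarrow> 'm) module" where
  "CE_cocycles1 L M act =
    \<lparr>carrier = {f \<in> linear_maps L M. \<forall>x\<in>carrier L. \<forall>y\<in>carrier L.
                  f (lie_bracket L x y) = act x (f y) \<ominus>\<^bsub>M\<^esub> act y (f x)},
     monoid.mult = undefined, one = undefined,
     zero = (\<lambda>x\<in>carrier L. \<zero>\<^bsub>M\<^esub>),
     add = (\<lambda>f g. \<lambda>x\<in>carrier L. f x \<oplus>\<^bsub>M\<^esub> g x),
     module.smult = (\<lambda>c f. \<lambda>x\<in>carrier L. c \<odot>\<^bsub>M\<^esub> f x)\<rparr>"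

definition CE_coboundaries1 ::
    "('k, 'g, 'c) lie_algebra_scheme \<Rightarrow> ('k, 'm, 'd) module_scheme \<Rightarrow> ('g \<Rightarrow> 'm \<Rightarrow> 'm)
      \<Rightarrow> ('g \<Rightarrow> 'm) set" where
  "CE_coboundaries1 L M act = (\<lambda>m. \<lambda>x\<in>carrier L. act x m) ` carrier M"

definition CE_H1 ::
    "('k, 'g, 'c) lie_algebra_scheme \<Rightarrow> ('k, 'm, 'd) module_scheme \<Rightarrow> ('g \<Rightarrow> 'm \<Rightarrow> 'm)
      \<Rightarrow> ('k, ('g \<Rightarrow> 'm) set) module" where
  "CE_H1 L M act = quotient_space (CE_cocycles1 L M act) (CE_coboundaries1 L M act)"

definition CE_class1 ::
    "('k, 'g, 'c) lie_algebra_scheme \<Rightarrow> ('k, 'm, 'd) module_scheme \<Rightarrow> ('g \<Rightarrow> 'm \<Rightarrow> 'm)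
      \<Rightarrow> ('g \<Rightarrow> 'm) \<Rightarrow> ('g \<Rightarrow> 'm) set" where
  "CE_class1 L M act f = CE_coboundaries1 L M act +>\<^bsub>CE_cocycles1 L M act\<^esub> f"


section \<open>Outer derivations and the divergence class\<close>

definition Der :: "('k, 'a, 'c) module_scheme \<Rightarrow> ('k, 'a \<Rightarrow> 'a) lie_algebra" where
  "Der A =
    \<lparr>carrier = {\<delta> \<in> linear_maps A A. \<forall>a\<in>carrier A. \<forall>b\<in>carrier A.
                  \<delta> (a \<otimes>\<^bsub>A\<^esub> b) = (\<delta> a \<otimes>\<^bsub>A\<^esub> b) \<oplus>\<^bsub>A\<^esub> (a \<otimes>\<^bsub>A\<^esub> \<delta> b)},
     monoid.mult = undefined, one = undefined,
     zero = (\<lambda>a\<in>carrier A. \<zero>\<^bsub>A\<^esub>),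
     add = (\<lambda>\<delta> \<epsilon>. \<lambda>a\<in>carrier A. \<delta> a \<oplus>\<^bsub>A\<^esub> \<epsilon> a),
     module.smult = (\<lambda>c \<delta>. \<lambda>a\<in>carrier A. c \<odot>\<^bsub>A\<^esub> \<delta> a),
     lie_bracket = (\<lambda>\<delta> \<epsilon>. \<lambda>a\<in>carrier A. \<delta> (\<epsilon> a) \<ominus>\<^bsub>A\<^esub> \<epsilon> (\<delta> a))\<rparr>"

definition InnDer :: "('k, 'a, 'c) module_scheme \<Rightarrow> ('a \<Rightarrow> 'a) set" where
  "InnDer A =
    (\<lambda>a. \<lambda>b\<in>carrier A. (a \<otimes>\<^bsub>A\<^esub> b) \<ominus>\<^bsub>A\<^esub> (b \<otimes>\<^bsub>A\<^esub> a)) ` carrier A"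

definition HH1 :: "('k, 'a, 'c) module_scheme \<Rightarrow> ('k, ('a \<Rightarrow> 'a) set) lie_algebra" where
  "HH1 A = quotient_lie_algebra (Der A) (InnDer A)"

definition alg_center :: "('k, 'a, 'c) module_scheme \<Rightarrow> ('k, 'a, 'c) module_scheme" where
  "alg_center A =
    A\<lparr>carrier := {z \<in> carrier A. \<forall>a\<in>carrier A. z \<otimes>\<^bsub>A\<^esub> a = a \<otimes>\<^bsub>A\<^esub> z}\<rparr>"

text \<open>
  A map on derivations that is constant on the cosets of \<open>InnDer A\<close> has singleton image on every
  coset; the induced map on the quotient is obtained with \<open>the_elem\<close>.
\<close>

definition HH1_act :: "('a \<Rightarrow> 'a) set \<Rightarrow> 'a \<Rightarrow> 'a" where
  "HH1_act S z = the_elem ((\<lambda>\<delta>. \<delta> z) ` S)"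

definition nakayama_div ::
    "('k::field, 'a, 'c) module_scheme \<Rightarrow> ('a \<Rightarrow> 'a \<Rightarrow> 'k) \<Rightarrow> ('a \<Rightarrow> 'a) \<Rightarrow> 'a" where
  "nakayama_div A form \<delta> =
    (THE d. d \<in> carrier A \<and>
       (\<forall>a\<in>carrier A. \<forall>b\<in>carrier A. form (\<delta> a) b + form a (\<delta> b) = form a (b \<otimes>\<^bsub>A\<^esub> d)))"

definition div_cocycle ::
    "('k::field, 'a, 'c) module_scheme \<Rightarrow> ('a \<Rightarrow> 'a \<Rightarrow> 'k) \<Rightarrow> ('a \<Rightarrow> 'a) set \<Rightarrow> 'a" where
  "div_cocycle A form = (\<lambda>S\<in>carrier (HH1 A). the_elem (nakayama_div A form ` S))"

definition Div_class ::
    "('k::field, 'a, 'c) module_scheme \<Rightarrow> ('a \<Rightarrow> 'a \<Rightarrow> 'k) \<Rightarrow> (('a \<Rightarrow> 'a) set \<Rightarrow> 'a) set" where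
  "Div_class A form = CE_class1 (HH1 A) (alg_center A) HH1_act (div_cocycle A form)"


section \<open>The exterior algebra\<close>

text \<open>
  The free associative unital algebra on the underlying set of \<open>V\<close> is the monoid algebra of the
  free monoid on that set.  Polynomial mappings write the exponent monoid additively, so
  concatenation of words is the operation \<open>+\<close>.
\<close>

datatype 'v free_monoid = Word (letters: "'v list")

instantiation free_monoid :: (type) monoid_add
begin

definition zero_free_monoid :: "'a free_monoid" where
  "0 = Word []"

definition plus_free_monoid :: "'a free_monoid \<Rightarrow> 'a free_monoid \<Rightarrow> 'a free_monoid" where
  "u + v = Word (letters u @ letters v)"

instance
  by standard (simp_all add: zero_free_monoid_def plus_free_monoid_def)

end

type_synonym ('k, 'v) free_algebra = "'v free_monoid \<Rightarrow>\<^sub>0 'k"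

abbreviation free_scalar :: "'k::field \<Rightarrow> ('k, 'v) free_algebra" where
  "free_scalar c \<equiv> Poly_Mapping.single 0 c"

abbreviation free_gen :: "'v \<Rightarrow> ('k::field, 'v) free_algebra" where
  "free_gen v \<equiv> Poly_Mapping.single (Word [v]) 1"

abbreviation free_ring :: "('k::field, 'v) free_algebra ring" where
  "free_ring \<equiv> ring_of_type_algebra"

text \<open>
  The first two families of relations turn the free algebra into the tensor algebra of \<open>V\<close>, the
  third one divides out the squares of vectors.
\<close>

definition ext_relations ::
    "('k::field \<Rightarrow> 'v::ab_group_add \<Rightarrow> 'v) \<Rightarrow> ('k, 'v) free_algebra set" where
  "ext_relations scale =
    {free_gen (v + w) - (free_gen v + free_gen w) | v w. True} \<union>
    {free_gen (scale c v) - free_scalar c * free_gen v | c v. True} \<union>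
    {free_gen v * free_gen v | v. True}"

definition ext_ideal ::
    "('k::field \<Rightarrow> 'v::ab_group_add \<Rightarrow> 'v) \<Rightarrow> ('k, 'v) free_algebra set" where
  "ext_ideal scale = Idl\<^bsub>free_ring\<^esub> (ext_relations scale)"

definition ext_proj ::
    "('k::field \<Rightarrow> 'v::ab_group_add \<Rightarrow> 'v) \<Rightarrow> ('k, 'v) free_algebra \<Rightarrow> ('k, 'v) free_algebra set"
  where "ext_proj scale p = ext_ideal scale +>\<^bsub>free_ring\<^esub> p"

definition exterior_algebra ::
    "('k::field \<Rightarrow> 'v::ab_group_add \<Rightarrow> 'v) \<Rightarrow> ('k, ('k, 'v) free_algebra set) module" where
  "exterior_algebra scale =
    ring.extend (free_ring Quot ext_ideal scale)
      \<lparr>module.smult = (\<lambda>c S. ext_proj scale (free_scalar c) \<otimes>\<^bsub>free_ring Quot ext_ideal scale\<^esub> S)\<rparr>"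

text \<open>
  The \<open>i\<close>-th exterior power is the image of the span of the words of length \<open>i\<close>,
  that is, of the \<open>i\<close>-th tensor power.
\<close>

definition ext_power ::
    "('k::field \<Rightarrow> 'v::ab_group_add \<Rightarrow> 'v) \<Rightarrow> nat \<Rightarrow> ('k, 'v) free_algebra set set" where
  "ext_power scale i =
    ext_proj scale ` {p. \<forall>w\<in>Poly_Mapping.keys p. length (letters w) = i}"

definition wedge ::
    "('k::field \<Rightarrow> 'v::ab_group_add \<Rightarrow> 'v) \<Rightarrow> 'v list \<Rightarrow> ('k, 'v) free_algebra set" where
  "wedge scale vs =
    foldr (\<lambda>v a. ext_proj scale (free_gen v) \<otimes>\<^bsub>exterior_algebra scale\<^esub> a) vs
      \<one>\<^bsub>exterior_algebra scale\<^esub>"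

definition ext_integral ::
    "('k::field \<Rightarrow> 'v::ab_group_add \<Rightarrow> 'v) \<Rightarrow> 'v list \<Rightarrow> ('k, 'v) free_algebra set \<Rightarrow> 'k" where
  "ext_integral scale xs =
    (THE f. f \<in> linear_maps (exterior_algebra scale) ground_field \<and>
       (\<forall>i<length xs. \<forall>a\<in>ext_power scale i. f a = 0) \<and>
       f (wedge scale xs) = 1)"

definition ext_form ::
    "('k::field \<Rightarrow> 'v::ab_group_add \<Rightarrow> 'v) \<Rightarrow> 'v list
      \<Rightarrow> ('k, 'v) free_algebra set \<Rightarrow> ('k, 'v) free_algebra set \<Rightarrow> 'k" where
  "ext_form scale xs a b = ext_integral scale xs (a \<otimes>\<^bsub>exterior_algebra scale\<^esub> b)"

end

theory Submission
  imports Defs "HOL-Combinatorics.Permutations"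
begin

text \<open>
  For a symmetric Frobenius algebra with trace form \<open>tr\<close>, the divergence of a derivation \<open>\<delta>\<close> is
  the element \<open>d\<close> with \<open>tr (\<delta> c) = tr (c d)\<close> for all \<open>c\<close>; from this its centrality and the
  cocycle identity are formal.  The trace on the exterior algebra comes from the
  determinant on words of length \<open>n\<close>; cyclic invariance holds because a cyclic rotation of an odd
  number of letters is an even permutation, and monomials of complementary subsets of the basis are
  dual up to sign.  The derivation with \<open>x\<^sub>1 \<mapsto> x\<^sub>1\<close> and \<open>x\<^sub>i \<mapsto> 0\<close> for \<open>i > 1\<close> fixes the top element
  \<open>\<omega> = x\<^sub>1 \<and> \<dots> \<and> x\<^sub>n\<close>, so that \<open>tr (\<omega> div \<delta>) = tr (\<delta> \<omega>) = 1\<close>, whereas \<open>\<omega> \<delta>(m) = 0\<close> for every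
  \<open>m\<close> because \<open>\<delta>(m)\<close> has no constant term.  (The Euler derivation,
  of divergence \<open>n\<close>, would not do when the characteristic divides \<open>n\<close>.)
\<close>

section \<open>Outer derivations of an algebra\<close>

text \<open>The scalars are a whole type and the ring need not be commutative, so the laws of an
  associative unital algebra are stated directly on top of \<open>ring\<close>.\<close>

locale k_algebra = ring A for A :: "('k::field, 'a, 'm) module_scheme" (structure) +
  assumes smult_closed [simp]: "a \<in> carrier A \<Longrightarrow> c \<odot> a \<in> carrier A"
    and smult_add_right: "\<lbrakk>a \<in> carrier A; b \<in> carrier A\<rbrakk> \<Longrightarrow> c \<odot> (a \<oplus> b) = c \<odot> a \<oplus> c \<odot> b"
    and smult_add_left: "a \<in> carrier A \<Longrightarrow> (c + d) \<odot> a = c \<odot> a \<oplus> d \<odot> a"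
    and smult_smult: "a \<in> carrier A \<Longrightarrow> c \<odot> (d \<odot> a) = (c * d) \<odot> a"
    and smult_one [simp]: "a \<in> carrier A \<Longrightarrow> 1 \<odot> a = a"
    and mult_smult_left: "\<lbrakk>a \<in> carrier A; b \<in> carrier A\<rbrakk> \<Longrightarrow> (c \<odot> a) \<otimes> b = c \<odot> (a \<otimes> b)"
    and mult_smult_right: "\<lbrakk>a \<in> carrier A; b \<in> carrier A\<rbrakk> \<Longrightarrow> a \<otimes> (c \<odot> b) = c \<odot> (a \<otimes> b)"
begin

section \<open>Scalars, linear endomorphisms and linear forms\<close>

lemma smult_zero_right [simp]: "c \<odot> \<zero> = \<zero>"
proof -
  have "c \<odot> \<zero> \<oplus> c \<odot> \<zero> = c \<odot> \<zero>"
    using smult_add_right[of \<zero> \<zero> c] by simp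
  then show ?thesis
    using add.l_cancel_one'[of "c \<odot> \<zero>" "c \<odot> \<zero>"] by simp
qed

lemma smult_minus_right: "a \<in> carrier A \<Longrightarrow> c \<odot> (\<ominus> a) = \<ominus> (c \<odot> a)"
  using smult_add_right[of "\<ominus> a" a c] by (simp add: l_neg add.inv_equality)

lemma smult_diff_right:
  "\<lbrakk>a \<in> carrier A; b \<in> carrier A\<rbrakk> \<Longrightarrow> c \<odot> (a \<ominus> b) = c \<odot> a \<ominus> c \<odot> b"
  by (simp add: minus_eq smult_add_right smult_minus_right)

lemma endo_closed: "\<lbrakk>f \<in> linear_maps A A; a \<in> carrier A\<rbrakk> \<Longrightarrow> f a \<in> carrier A"
  by (auto simp: linear_maps_def)

lemma endo_add:
  "\<lbrakk>f \<in> linear_maps A A; a \<in> carrier A; b \<in> carrier A\<rbrakk> \<Longrightarrow> f (a \<oplus> b) = f a \<oplus> f b"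
  by (auto simp: linear_maps_def)

lemma endo_smult: "\<lbrakk>f \<in> linear_maps A A; a \<in> carrier A\<rbrakk> \<Longrightarrow> f (c \<odot> a) = c \<odot> f a"
  by (auto simp: linear_maps_def)

lemma endo_zero:
  assumes "f \<in> linear_maps A A"
  shows "f \<zero> = \<zero>"
proof -
  have "f \<zero> \<oplus> f \<zero> = f \<zero>"
    using endo_add[OF assms, of \<zero> \<zero>] by simp
  then show ?thesis
    using add.l_cancel_one'[of "f \<zero>" "f \<zero>"] endo_closed[OF assms, of \<zero>] by simp
qed

lemma endo_minus: "\<lbrakk>f \<in> linear_maps A A; a \<in> carrier A\<rbrakk> \<Longrightarrow> f (\<ominus> a) = \<ominus> f a"
  using endo_add[of f "\<ominus> a" a] by (simp add: l_neg endo_zero endo_closed add.inv_equality)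

lemma endo_diff:
  "\<lbrakk>f \<in> linear_maps A A; a \<in> carrier A; b \<in> carrier A\<rbrakk> \<Longrightarrow> f (a \<ominus> b) = f a \<ominus> f b"
  by (simp add: minus_eq endo_add endo_minus)

lemma endoI:
  assumes "\<And>a. a \<in> carrier A \<Longrightarrow> f a \<in> carrier A"
    and "\<And>a b. \<lbrakk>a \<in> carrier A; b \<in> carrier A\<rbrakk> \<Longrightarrow> f (a \<oplus> b) = f a \<oplus> f b"
    and "\<And>c a. a \<in> carrier A \<Longrightarrow> f (c \<odot> a) = c \<odot> f a"
  shows "restrict f (carrier A) \<in> linear_maps A A"
  using assms by (auto simp: linear_maps_def)

lemma linear_maps_eqI:
  assumes "f \<in> linear_maps A M" "g \<in> linear_maps A M" "\<And>a. a \<in> carrier A \<Longrightarrow> f a = g a"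
  shows "f = g"
  using assms by (auto simp: linear_maps_def intro: PiE_ext)

lemma functional_add:
  "\<lbrakk>f \<in> linear_maps A ground_field; a \<in> carrier A; b \<in> carrier A\<rbrakk> \<Longrightarrow> f (a \<oplus> b) = f a + f b"
  by (auto simp: linear_maps_def ground_field_def)

lemma functional_smult:
  "\<lbrakk>f \<in> linear_maps A ground_field; a \<in> carrier A\<rbrakk> \<Longrightarrow> f (c \<odot> a) = c * f a"
  by (auto simp: linear_maps_def ground_field_def)

lemma functional_zero:
  assumes "f \<in> linear_maps A ground_field"
  shows "f \<zero> = 0"
  using functional_add[OF assms, of \<zero> \<zero>] by (metis add_cancel_right_right l_zero zero_closed)

lemma functional_minus:
  "\<lbrakk>f \<in> linear_maps A ground_field; a \<in> carrier A\<rbrakk> \<Longrightarrow> f (\<ominus> a) = - f a"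
  using functional_add[of f "\<ominus> a" a] by (simp add: l_neg functional_zero eq_neg_iff_add_eq_0)

lemma functional_diff:
  "\<lbrakk>f \<in> linear_maps A ground_field; a \<in> carrier A; b \<in> carrier A\<rbrakk> \<Longrightarrow> f (a \<ominus> b) = f a - f b"
  by (simp add: minus_eq functional_add functional_minus)

lemma functionalI:
  assumes "\<And>a b. \<lbrakk>a \<in> carrier A; b \<in> carrier A\<rbrakk> \<Longrightarrow> f (a \<oplus> b) = f a + f b"
    and "\<And>c a. a \<in> carrier A \<Longrightarrow> f (c \<odot> a) = c * f a"
  shows "restrict f (carrier A) \<in> linear_maps A ground_field"
  using assms by (auto simp: linear_maps_def ground_field_def)

section \<open>The Lie algebra of derivations\<close>

lemma Der_linear: "\<delta> \<in> carrier (Der A) \<Longrightarrow> \<delta> \<in> linear_maps A A"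
  by (simp add: Der_def)

lemmas Der_closed [simp] = endo_closed[OF Der_linear]
  and Der_sum = endo_add[OF Der_linear]
  and Der_scale = endo_smult[OF Der_linear]
  and Der_at_zero = endo_zero[OF Der_linear]
  and Der_diff = endo_diff[OF Der_linear]

lemma Der_mult:
  "\<lbrakk>\<delta> \<in> carrier (Der A); a \<in> carrier A; b \<in> carrier A\<rbrakk>
    \<Longrightarrow> \<delta> (a \<otimes> b) = (\<delta> a \<otimes> b) \<oplus> (a \<otimes> \<delta> b)"
  by (simp add: Der_def)

text \<open>The Leibniz rule solved for its last term. Under a trace this is integration by parts,
  the form needed for the cocycle identity.\<close>

lemma Der_mult_left:
  "\<lbrakk>\<delta> \<in> carrier (Der A); a \<in> carrier A; b \<in> carrier A\<rbrakk>
    \<Longrightarrow> a \<otimes> \<delta> b = \<delta> (a \<otimes> b) \<ominus> (\<delta> a \<otimes> b)"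
  by (simp add: Der_mult minus_eq a_ac r_neg2 r_neg)

lemma DerI:
  assumes "\<delta> \<in> linear_maps A A"
    and "\<And>a b. \<lbrakk>a \<in> carrier A; b \<in> carrier A\<rbrakk> \<Longrightarrow> \<delta> (a \<otimes> b) = (\<delta> a \<otimes> b) \<oplus> (a \<otimes> \<delta> b)"
  shows "\<delta> \<in> carrier (Der A)"
  using assms by (simp add: Der_def)

lemma Der_eqI:
  assumes "\<delta> \<in> carrier (Der A)" "\<epsilon> \<in> carrier (Der A)" "\<And>a. a \<in> carrier A \<Longrightarrow> \<delta> a = \<epsilon> a"
  shows "\<delta> = \<epsilon>"
  using linear_maps_eqI[OF Der_linear Der_linear] assms .

lemma Der_simps:
  "zero (Der A) = (\<lambda>a\<in>carrier A. \<zero>)"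
  "add (Der A) = (\<lambda>\<delta> \<epsilon>. \<lambda>a\<in>carrier A. \<delta> a \<oplus> \<epsilon> a)"
  "module.smult (Der A) = (\<lambda>c \<delta>. \<lambda>a\<in>carrier A. c \<odot> \<delta> a)"
  "lie_bracket (Der A) = (\<lambda>\<delta> \<epsilon>. \<lambda>a\<in>carrier A. \<delta> (\<epsilon> a) \<ominus> \<epsilon> (\<delta> a))"
  by (simp_all add: Der_def)

lemma Der_zero_in: "\<zero>\<^bsub>Der A\<^esub> \<in> carrier (Der A)"
  by (rule DerI) (auto simp: Der_simps intro: endoI)

lemma Der_add_in:
  assumes "\<delta> \<in> carrier (Der A)" "\<epsilon> \<in> carrier (Der A)"
  shows "\<delta> \<oplus>\<^bsub>Der A\<^esub> \<epsilon> \<in> carrier (Der A)"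
proof (rule DerI)
  show "\<delta> \<oplus>\<^bsub>Der A\<^esub> \<epsilon> \<in> linear_maps A A"
    unfolding Der_simps
    by (rule endoI) (use assms in \<open>simp_all add: Der_sum Der_scale smult_add_right a_ac\<close>)
  show "(\<delta> \<oplus>\<^bsub>Der A\<^esub> \<epsilon>) (a \<otimes> b) = ((\<delta> \<oplus>\<^bsub>Der A\<^esub> \<epsilon>) a \<otimes> b) \<oplus> (a \<otimes> (\<delta> \<oplus>\<^bsub>Der A\<^esub> \<epsilon>) b)"
    if "a \<in> carrier A" "b \<in> carrier A" for a b
    using assms that by (simp add: Der_simps Der_mult l_distr r_distr a_ac)
qed

lemma Der_smult_in:
  assumes "\<delta> \<in> carrier (Der A)"
  shows "c \<odot>\<^bsub>Der A\<^esub> \<delta> \<in> carrier (Der A)"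
proof (rule DerI)
  show "c \<odot>\<^bsub>Der A\<^esub> \<delta> \<in> linear_maps A A"
    unfolding Der_simps
    by (rule endoI)
      (use assms in \<open>simp_all add: Der_sum Der_scale smult_add_right smult_smult mult.commute\<close>)
  show "(c \<odot>\<^bsub>Der A\<^esub> \<delta>) (a \<otimes> b) = ((c \<odot>\<^bsub>Der A\<^esub> \<delta>) a \<otimes> b) \<oplus> (a \<otimes> (c \<odot>\<^bsub>Der A\<^esub> \<delta>) b)"
    if "a \<in> carrier A" "b \<in> carrier A" for a b
    using assms that
        by (simp add: Der_simps Der_mult smult_add_right mult_smult_left mult_smult_right)
qed

lemma Der_bracket_in:
  assumes "\<delta> \<in> carrier (Der A)" "\<epsilon> \<in> carrier (Der A)"
  shows "lie_bracket (Der A) \<delta> \<epsilon> \<in> carrier (Der A)"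
proof (rule DerI)
  show "lie_bracket (Der A) \<delta> \<epsilon> \<in> linear_maps A A"
    unfolding Der_simps
  proof (rule endoI)
    fix a b assume ab: "a \<in> carrier A" "b \<in> carrier A"
    then show "\<delta> (\<epsilon> (a \<oplus> b)) \<ominus> \<epsilon> (\<delta> (a \<oplus> b)) = \<delta> (\<epsilon> a) \<ominus> \<epsilon> (\<delta> a) \<oplus> (\<delta> (\<epsilon> b) \<ominus> \<epsilon> (\<delta> b))"
      using assms by (simp add: Der_sum minus_eq minus_add a_ac)
  qed (use assms in \<open>simp_all add: Der_scale smult_diff_right\<close>)
  show "lie_bracket (Der A) \<delta> \<epsilon> (a \<otimes> b)
      = (lie_bracket (Der A) \<delta> \<epsilon> a \<otimes> b) \<oplus> (a \<otimes> lie_bracket (Der A) \<delta> \<epsilon> b)"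
    if ab: "a \<in> carrier A" "b \<in> carrier A" for a b
  proof -
    \<comment> \<open>The mixed products \<open>\<epsilon> a \<otimes> \<delta> b\<close> (here
      \<open>v\<close>) and \<open>\<delta> a \<otimes> \<epsilon> b\<close> (here \<open>w\<close>)
      occur in both compositions and drop out of the commutator.\<close>
    have cancel: "u \<oplus> v \<oplus> (w \<oplus> z) \<ominus> (p \<oplus> w \<oplus> (v \<oplus> q)) = u \<ominus> p \<oplus> (z \<ominus> q)"
      if "u \<in> carrier A" "v \<in> carrier A" "w \<in> carrier A" "z \<in> carrier A"
        "p \<in> carrier A" "q \<in> carrier A" for u v w z p q
      using that by algebra
    show ?thesis
      using assms ab
          by (simp add: Der_simps Der_mult Der_sum cancel minus_eq[symmetric] l_minus r_minus
        l_distr r_distr) (simp add: minus_eq l_distr r_distr l_minus r_minus)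
  qed
qed

sublocale Der: abelian_group "Der A"
proof (rule abelian_groupI)
  show "\<exists>\<epsilon>\<in>carrier (Der A). \<epsilon> \<oplus>\<^bsub>Der A\<^esub> \<delta> = \<zero>\<^bsub>Der A\<^esub>" if "\<delta> \<in> carrier (Der A)" for \<delta>
  proof
    let ?\<epsilon> = "\<lambda>a\<in>carrier A. \<ominus> \<delta> a"
    have "?\<epsilon> \<in> linear_maps A A"
      by (rule endoI)
        (use that in \<open>simp_all add: Der_sum Der_scale smult_minus_right minus_add\<close>)
    then show "?\<epsilon> \<in> carrier (Der A)"
      by (rule DerI) (use that in \<open>simp_all add: Der_mult l_minus r_minus minus_add\<close>)
    show "?\<epsilon> \<oplus>\<^bsub>Der A\<^esub> \<delta> = \<zero>\<^bsub>Der A\<^esub>"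
      using that by (auto simp: Der_simps l_neg)
  qed
  show "\<zero>\<^bsub>Der A\<^esub> \<oplus>\<^bsub>Der A\<^esub> \<delta> = \<delta>" if "\<delta> \<in> carrier (Der A)" for \<delta>
    by (rule Der_eqI) (use that in \<open>simp_all add: Der_add_in Der_zero_in, simp add: Der_simps\<close>)
qed (auto simp: Der_add_in Der_zero_in, auto simp: Der_simps a_ac intro!: restrict_ext)

section \<open>Inner derivations\<close>

definition ad :: "'a \<Rightarrow> 'a \<Rightarrow> 'a" where
  "ad a = (\<lambda>b\<in>carrier A. (a \<otimes> b) \<ominus> (b \<otimes> a))"

lemma InnDer_eq: "InnDer A = ad ` carrier A"
  by (simp add: InnDer_def ad_def[abs_def])

lemma ad_in_Der:
  assumes "a \<in> carrier A"
  shows "ad a \<in> carrier (Der A)"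
proof (rule DerI)
  show "ad a \<in> linear_maps A A"
    unfolding ad_def
  proof (rule endoI)
    show "a \<otimes> (b \<oplus> c) \<ominus> (b \<oplus> c) \<otimes> a = a \<otimes> b \<ominus> b \<otimes> a \<oplus> (a \<otimes> c \<ominus> c \<otimes> a)"
      if "b \<in> carrier A" "c \<in> carrier A" for b c
      using assms that by algebra
  qed (use assms in \<open>simp_all add: mult_smult_left mult_smult_right smult_diff_right\<close>)
  show "ad a (b \<otimes> c) = (ad a b \<otimes> c) \<oplus> (b \<otimes> ad a c)"
    if bc: "b \<in> carrier A" "c \<in> carrier A" for b c
  proof -
    have "a \<otimes> (b \<otimes> c) \<ominus> (b \<otimes> c) \<otimes> a
        = (a \<otimes> b \<ominus> b \<otimes> a) \<otimes> c \<oplus> b \<otimes> (a \<otimes> c \<ominus> c \<otimes> a)"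
      using assms bc by algebra
    then show ?thesis
      using bc by (simp add: ad_def)
  qed
qed

lemma ad_zero: "ad \<zero> = \<zero>\<^bsub>Der A\<^esub>"
  by (auto simp: ad_def Der_simps minus_eq)

lemma ad_add:
  assumes "a \<in> carrier A" "b \<in> carrier A"
  shows "ad (a \<oplus> b) = ad a \<oplus>\<^bsub>Der A\<^esub> ad b"
proof -
  have "(a \<oplus> b) \<otimes> c \<ominus> c \<otimes> (a \<oplus> b) = a \<otimes> c \<ominus> c \<otimes> a \<oplus> (b \<otimes> c \<ominus> c \<otimes> b)"
    if "c \<in> carrier A" for c
    using assms that by algebra
  then show ?thesis
    by (auto simp: ad_def Der_simps)
qed

lemma ad_smult:
  assumes "a \<in> carrier A"
  shows "ad (c \<odot> a) = c \<odot>\<^bsub>Der A\<^esub> ad a"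
  using assms
  by (auto simp: ad_def Der_simps mult_smult_left mult_smult_right smult_diff_right)

text \<open>Makes \<open>InnDer A\<close> a Lie ideal, which the bracket on the quotient requires.
  After the Leibniz rule, the products of \<open>a\<close> with \<open>\<delta> b\<close>
  cancel.\<close>

lemma bracket_ad:
  assumes "\<delta> \<in> carrier (Der A)" "a \<in> carrier A"
  shows "lie_bracket (Der A) \<delta> (ad a) = ad (\<delta> a)"
proof (rule Der_eqI)
  fix b assume b: "b \<in> carrier A"
  have cancel: "u \<oplus> v \<ominus> (w \<oplus> z) \<ominus> (v \<ominus> w) = u \<ominus> z"
    if "u \<in> carrier A" "v \<in> carrier A" "w \<in> carrier A" "z \<in> carrier A" for u v w z
    using that by algebra
  show "lie_bracket (Der A) \<delta> (ad a) b = ad (\<delta> a) b"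
    using assms b by (simp add: Der_simps ad_def Der_diff Der_mult cancel)
qed (use assms in \<open>simp_all add: Der_bracket_in ad_in_Der\<close>)

lemma ad_central: "\<lbrakk>a \<in> carrier A; z \<in> carrier (alg_center A)\<rbrakk> \<Longrightarrow> ad a z = \<zero>"
  by (simp add: ad_def alg_center_def)

lemma ad_in_InnDer: "a \<in> carrier A \<Longrightarrow> ad a \<in> InnDer A"
  by (simp add: InnDer_eq)

sublocale InnDer: abelian_subgroup "InnDer A" "Der A"
proof (rule abelian_subgroupI3)
  show "additive_subgroup (InnDer A) (Der A)"
  proof (rule additive_subgroup.intro, rule group.subgroupI[OF Der.a_group])
    show "InnDer A \<subseteq> carrier (add_monoid (Der A))"
      by (auto simp: InnDer_eq ad_in_Der)
    show "InnDer A \<noteq> {}"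
      by (auto simp: InnDer_eq)
    show "inv\<^bsub>add_monoid (Der A)\<^esub> h \<in> InnDer A" if "h \<in> InnDer A" for h
    proof -
      obtain a where a: "a \<in> carrier A" "h = ad a"
        using \<open>h \<in> InnDer A\<close> by (auto simp: InnDer_eq)
      then have "ad (\<ominus> a) \<oplus>\<^bsub>Der A\<^esub> ad a = \<zero>\<^bsub>Der A\<^esub>"
        by (simp add: ad_add[symmetric] l_neg ad_zero)
      then have "\<ominus>\<^bsub>Der A\<^esub> h = ad (\<ominus> a)"
        using a by (intro Der.minus_equality) (simp_all add: ad_in_Der)
      then show ?thesis
        using a by (auto simp: InnDer_eq a_inv_def)
    qed
    show "monoid.mult (add_monoid (Der A)) g h \<in> InnDer A" if "g \<in> InnDer A" "h \<in> InnDer A" for g h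
      using that by (auto simp: InnDer_eq ad_add[symmetric])
  qed
qed (rule Der.abelian_group_axioms)

section \<open>Outer derivations and their action on the center\<close>

abbreviation cls :: "('a \<Rightarrow> 'a) \<Rightarrow> ('a \<Rightarrow> 'a) set" where
  "cls \<delta> \<equiv> InnDer A +>\<^bsub>Der A\<^esub> \<delta>"

lemma InnDer_sub_Der: "h \<in> InnDer A \<Longrightarrow> h \<in> carrier (Der A)"
  by (auto simp: InnDer_eq ad_in_Der)

lemma cls_absorb:
  "\<lbrakk>h \<in> InnDer A; \<delta> \<in> carrier (Der A)\<rbrakk> \<Longrightarrow> cls (h \<oplus>\<^bsub>Der A\<^esub> \<delta>) = cls \<delta>"
  by (metis Der.a_coset_add_assoc InnDer.a_rcos_const InnDer.a_subset InnDer_sub_Der)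

lemma cls_iff:
  "\<epsilon> \<in> cls \<delta> \<longleftrightarrow> (\<exists>a\<in>carrier A. \<epsilon> = ad a \<oplus>\<^bsub>Der A\<^esub> \<delta>)"
  by (auto simp: a_r_coset_def' InnDer_eq)

lemma cls_self: "\<delta> \<in> carrier (Der A) \<Longrightarrow> \<delta> \<in> cls \<delta>"
  by (rule InnDer.a_rcos_self)

text \<open>Turns the maps defined through \<open>the_elem\<close> on cosets, namely the action and
  the divergence cocycle, into evaluation at a representative.\<close>

lemma the_elem_image_cls:
  assumes "\<delta> \<in> carrier (Der A)"
    and "\<And>a. a \<in> carrier A \<Longrightarrow> f (ad a \<oplus>\<^bsub>Der A\<^esub> \<delta>) = f \<delta>"
  shows "the_elem (f ` cls \<delta>) = f \<delta>"
proof -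
  have "f ` cls \<delta> = {f \<delta>}"
    using assms cls_self by (auto simp: cls_iff)
  then show ?thesis
    by simp
qed

lemma HH1_simps:
  "carrier (HH1 A) = cls ` carrier (Der A)"
  "add (HH1 A) = set_add (Der A)"
  "module.smult (HH1 A) = (\<lambda>c S. \<Union>u\<in>S. cls (c \<odot>\<^bsub>Der A\<^esub> u))"
  "lie_bracket (HH1 A) = (\<lambda>S T. \<Union>x\<in>S. \<Union>y\<in>T. cls (lie_bracket (Der A) x y))"
  by (auto simp: HH1_def quotient_lie_algebra_def quotient_space_def module.defs A_RCOSETS_def')

lemma HH1_add:
  "\<lbrakk>\<delta> \<in> carrier (Der A); \<epsilon> \<in> carrier (Der A)\<rbrakk>
    \<Longrightarrow> cls \<delta> \<oplus>\<^bsub>HH1 A\<^esub> cls \<epsilon> = cls (\<delta> \<oplus>\<^bsub>Der A\<^esub> \<epsilon>)"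
  by (simp add: HH1_simps InnDer.a_rcos_sum)

text \<open>The quotient operation is a union over all representatives. It collapses to a single
  coset because \<open>c \<odot> ad a\<close> is again inner, so that every member of the union is
  the same coset.\<close>

lemma HH1_smult:
  assumes "\<delta> \<in> carrier (Der A)"
  shows "c \<odot>\<^bsub>HH1 A\<^esub> cls \<delta> = cls (c \<odot>\<^bsub>Der A\<^esub> \<delta>)"
proof -
  have "cls (c \<odot>\<^bsub>Der A\<^esub> \<epsilon>) = cls (c \<odot>\<^bsub>Der A\<^esub> \<delta>)" if "\<epsilon> \<in> cls \<delta>" for \<epsilon>
  proof -
    obtain a where a: "a \<in> carrier A" "\<epsilon> = ad a \<oplus>\<^bsub>Der A\<^esub> \<delta>"
      using \<open>\<epsilon> \<in> cls \<delta>\<close> by (auto simp: cls_iff)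
    have "c \<odot>\<^bsub>Der A\<^esub> \<epsilon> = ad (c \<odot> a) \<oplus>\<^bsub>Der A\<^esub> (c \<odot>\<^bsub>Der A\<^esub> \<delta>)"
      unfolding a(2) ad_smult[OF a(1)] Der_simps
      by (rule restrict_ext) (use ad_in_Der[OF a(1)] assms in \<open>simp add: smult_add_right\<close>)
    then show ?thesis
      using a assms by (simp add: cls_absorb ad_in_InnDer Der_smult_in)
  qed
  moreover have "cls \<delta> \<noteq> {}"
    using cls_self[OF assms] by blast
  ultimately show ?thesis
    unfolding HH1_simps by (intro SUP_eq_const)
qed

text \<open>Independence of the second representative is \<open>bracket_ad\<close>; independence of
  the first reduces to it by antisymmetry of the bracket. As for scaling, the union then consists of
  equal cosets.\<close>

lemma HH1_bracket:
  assumes "\<delta> \<in> carrier (Der A)" "\<epsilon> \<in> carrier (Der A)"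
  shows "lie_bracket (HH1 A) (cls \<delta>) (cls \<epsilon>) = cls (lie_bracket (Der A) \<delta> \<epsilon>)"
proof -
  have bracket_antisym:
    "lie_bracket (Der A) \<alpha> \<beta> = \<ominus>\<^bsub>Der A\<^esub> lie_bracket (Der A) \<beta> \<alpha>"
    if "\<alpha> \<in> carrier (Der A)" "\<beta> \<in> carrier (Der A)" for \<alpha> \<beta>
  proof -
    have "lie_bracket (Der A) \<alpha> \<beta> \<oplus>\<^bsub>Der A\<^esub> lie_bracket (Der A) \<beta> \<alpha> = \<zero>\<^bsub>Der A\<^esub>"
    proof (rule Der_eqI)
      fix a assume "a \<in> carrier A"
      then have "\<alpha> (\<beta> a) \<in> carrier A" "\<beta> (\<alpha> a) \<in> carrier A"
        using that by simp_all
      then have "\<alpha> (\<beta> a) \<ominus> \<beta> (\<alpha> a) \<oplus> (\<beta> (\<alpha> a) \<ominus> \<alpha> (\<beta> a)) = \<zero>"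
        by algebra
      then show "(lie_bracket (Der A) \<alpha> \<beta> \<oplus>\<^bsub>Der A\<^esub> lie_bracket (Der A) \<beta> \<alpha>) a = \<zero>\<^bsub>Der A\<^esub> a"
        using \<open>a \<in> carrier A\<close> by (simp add: Der_simps)
    qed (use that in \<open>simp_all add: Der_bracket_in Der_add_in Der_zero_in\<close>)
    then show ?thesis
      using that by (intro Der.minus_equality[symmetric]) (simp_all add: Der_bracket_in)
  qed
  have right: "cls (lie_bracket (Der A) \<alpha> \<gamma>) = cls (lie_bracket (Der A) \<alpha> \<beta>)"
    if "\<alpha> \<in> carrier (Der A)" "\<beta> \<in> carrier (Der A)" "\<gamma> \<in> cls \<beta>" for \<alpha> \<beta> \<gamma>
  proof -
    obtain a where a: "a \<in> carrier A" "\<gamma> = ad a \<oplus>\<^bsub>Der A\<^esub> \<beta>"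
      using \<open>\<gamma> \<in> cls \<beta>\<close> by (auto simp: cls_iff)
    have "lie_bracket (Der A) \<alpha> \<gamma>
        = lie_bracket (Der A) \<alpha> (ad a) \<oplus>\<^bsub>Der A\<^esub> lie_bracket (Der A) \<alpha> \<beta>"
      unfolding a(2) Der_simps
      by (rule restrict_ext)
        (use ad_in_Der[OF a(1)] that in \<open>simp add: Der_sum[of \<alpha>] minus_eq minus_add a_ac\<close>)
    then show ?thesis
      using a that by (simp add: bracket_ad cls_absorb ad_in_InnDer Der_bracket_in)
  qed
  have left: "cls (lie_bracket (Der A) \<gamma> \<alpha>) = cls (lie_bracket (Der A) \<beta> \<alpha>)"
    if "\<alpha> \<in> carrier (Der A)" "\<beta> \<in> carrier (Der A)" "\<gamma> \<in> cls \<beta>" for \<alpha> \<beta> \<gamma>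
  proof -
    obtain a where a: "a \<in> carrier A" "\<gamma> = ad a \<oplus>\<^bsub>Der A\<^esub> \<beta>"
      using \<open>\<gamma> \<in> cls \<beta>\<close> by (auto simp: cls_iff)
    have \<gamma>: "\<gamma> \<in> carrier (Der A)"
      using a that by (simp add: Der_add_in ad_in_Der)
    have "lie_bracket (Der A) \<gamma> \<alpha>
        = lie_bracket (Der A) (ad a) \<alpha> \<oplus>\<^bsub>Der A\<^esub> lie_bracket (Der A) \<beta> \<alpha>"
      unfolding a(2) Der_simps
      by (rule restrict_ext)
        (use ad_in_Der[OF a(1)] that in \<open>simp add: Der_sum[of \<alpha>] minus_eq minus_add a_ac\<close>)
    moreover have "lie_bracket (Der A) (ad a) \<alpha> \<in> InnDer A"
      using bracket_antisym[of "ad a" \<alpha>] a that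
      by (simp add: bracket_ad ad_in_Der ad_in_InnDer)
    ultimately show ?thesis
      using that by (simp add: cls_absorb Der_bracket_in)
  qed
  have "cls (lie_bracket (Der A) \<delta>' \<epsilon>') = cls (lie_bracket (Der A) \<delta> \<epsilon>)"
    if "\<delta>' \<in> cls \<delta>" "\<epsilon>' \<in> cls \<epsilon>" for \<delta>' \<epsilon>'
  proof -
    have "\<delta>' \<in> carrier (Der A)"
      using that assms by (auto simp: cls_iff Der_add_in ad_in_Der)
    then show ?thesis
      using right[of \<delta>' \<epsilon> \<epsilon>'] left[of \<epsilon> \<delta> \<delta>'] assms that by simp
  qed
  moreover have "cls \<delta> \<noteq> {}" "cls \<epsilon> \<noteq> {}"
    using cls_self assms by blast+
  ultimately show ?thesis
    unfolding HH1_simps by (intro SUP_eq_const)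
qed

text \<open>The representative does not matter because inner derivations vanish on central
  elements.\<close>

lemma HH1_act_cls:
  assumes "\<delta> \<in> carrier (Der A)" "z \<in> carrier (alg_center A)"
  shows "HH1_act (cls \<delta>) z = \<delta> z"
  unfolding HH1_act_def
proof (rule the_elem_image_cls)
  have "z \<in> carrier A"
    using assms(2) by (simp add: alg_center_def)
  then show "(ad a \<oplus>\<^bsub>Der A\<^esub> \<delta>) z = \<delta> z" if "a \<in> carrier A" for a
    using assms that by (simp add: Der_simps ad_central)
qed (rule assms)

end

section \<open>The divergence class of a symmetric Frobenius algebra\<close>

text \<open>The Frobenius form is encoded by its trace, so that associativity of the form is
  associativity of the product. \<open>representable\<close> takes the place of finite dimension and
  supplies the existence of divergences.\<close>

locale symmetric_frobenius_algebra = k_algebra A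
  for A :: "('k::field, 'a, 'm) module_scheme" (structure) +
  fixes tr :: "'a \<Rightarrow> 'k"
  assumes tr_linear: "tr \<in> linear_maps A ground_field"
    and tr_comm: "\<lbrakk>a \<in> carrier A; b \<in> carrier A\<rbrakk> \<Longrightarrow> tr (a \<otimes> b) = tr (b \<otimes> a)"
    and nondegenerate:
      "\<lbrakk>a \<in> carrier A; \<And>b. b \<in> carrier A \<Longrightarrow> tr (b \<otimes> a) = 0\<rbrakk> \<Longrightarrow> a = \<zero>"
    and representable:
      "\<phi> \<in> linear_maps A ground_field \<Longrightarrow> \<exists>d\<in>carrier A. \<forall>b\<in>carrier A. \<phi> b = tr (b \<otimes> d)"
begin

abbreviation form :: "'a \<Rightarrow> 'a \<Rightarrow> 'k" where
  "form \<equiv> \<lambda>a b. tr (a \<otimes> b)"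

abbreviation dv :: "('a \<Rightarrow> 'a) \<Rightarrow> 'a" where
  "dv \<equiv> nakayama_div A form"

lemmas tr_add = functional_add[OF tr_linear]
  and tr_diff = functional_diff[OF tr_linear]
  and tr_smult = functional_smult[OF tr_linear]

section \<open>The divergence of a derivation\<close>

lemma nondegenerate_eqI:
  assumes "a \<in> carrier A" "b \<in> carrier A"
    and "\<And>c. c \<in> carrier A \<Longrightarrow> tr (c \<otimes> a) = tr (c \<otimes> b)"
  shows "a = b"
proof -
  have "tr (c \<otimes> (a \<ominus> b)) = 0" if "c \<in> carrier A" for c
  proof -
    have "c \<otimes> (a \<ominus> b) = c \<otimes> a \<ominus> c \<otimes> b"
      using assms that by algebra
    then show ?thesis
      using assms that by (simp add: tr_diff)
  qed
  then have "a \<ominus> b = \<zero>"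
    using assms by (intro nondegenerate) simp_all
  then show ?thesis
    using assms by simp
qed

text \<open>By the Leibniz rule the left-hand side of the defining condition is
  \<open>tr (\<delta> (a \<otimes> b))\<close>, so the condition depends only on the product of
  \<open>a\<close> and \<open>b\<close>. Taking \<open>b = \<one>\<close> shows that it is
  equivalent to the one-variable condition assumed here; nondegeneracy gives uniqueness.\<close>

lemma dv_eqI:
  assumes \<delta>: "\<delta> \<in> carrier (Der A)" and d: "d \<in> carrier A"
    and *: "\<And>c. c \<in> carrier A \<Longrightarrow> tr (\<delta> c) = tr (c \<otimes> d)"
  shows "dv \<delta> = d"
  unfolding nakayama_div_def
proof (rule the_equality)
  have "form (\<delta> a) b + form a (\<delta> b) = form a (b \<otimes> d)"
    if "a \<in> carrier A" "b \<in> carrier A" for a b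
    using *[of "a \<otimes> b"] \<delta> d that by (simp add: Der_mult tr_add m_assoc)
  then show "d \<in> carrier A \<and>
      (\<forall>a\<in>carrier A. \<forall>b\<in>carrier A. form (\<delta> a) b + form a (\<delta> b) = form a (b \<otimes> d))"
    using d by blast
  fix e assume e: "e \<in> carrier A \<and>
      (\<forall>a\<in>carrier A. \<forall>b\<in>carrier A. form (\<delta> a) b + form a (\<delta> b) = form a (b \<otimes> e))"
  show "e = d"
  proof (rule nondegenerate_eqI)
    fix c assume c: "c \<in> carrier A"
    have "form (\<delta> c) \<one> + form c (\<delta> \<one>) = form c (\<one> \<otimes> e)"
      using e c by blast
    moreover have "tr (\<delta> (c \<otimes> \<one>)) = form (\<delta> c) \<one> + form c (\<delta> \<one>)"
      using Der_mult[OF \<delta> c one_closed] \<delta> c by (simp add: tr_add del: r_one)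
    ultimately show "tr (c \<otimes> e) = tr (c \<otimes> d)"
      using * c e by simp
  qed (use e d in auto)
qed

text \<open>Existence: the element representing the linear form \<open>tr \<circ> \<delta>\<close>
  is the divergence.\<close>

lemma
  assumes "\<delta> \<in> carrier (Der A)"
  shows dv_closed [simp]: "dv \<delta> \<in> carrier A"
    and tr_dv: "c \<in> carrier A \<Longrightarrow> tr (\<delta> c) = tr (c \<otimes> dv \<delta>)"
proof -
  have "(\<lambda>c\<in>carrier A. tr (\<delta> c)) \<in> linear_maps A ground_field"
    by (rule functionalI) (use assms in \<open>simp_all add: Der_sum Der_scale tr_add tr_smult\<close>)
  from representable[OF this] obtain d where d: "d \<in> carrier A"
    and *: "\<And>c. c \<in> carrier A \<Longrightarrow> tr (\<delta> c) = tr (c \<otimes> d)"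
    by auto
  have "dv \<delta> = d"
    using assms d * by (rule dv_eqI)
  then show "dv \<delta> \<in> carrier A" "c \<in> carrier A \<Longrightarrow> tr (\<delta> c) = tr (c \<otimes> dv \<delta>)"
    using d * by simp_all
qed

text \<open>The form \<open>tr \<circ> \<delta>\<close> is symmetric too: expand
  \<open>\<delta> (a \<otimes> c)\<close> by Leibniz and swap the factors of both terms under the
  trace. Comparing \<open>a \<otimes> c\<close> with \<open>c \<otimes> a\<close> then gives
  centrality.\<close>

lemma dv_central:
  assumes "\<delta> \<in> carrier (Der A)"
  shows "dv \<delta> \<in> carrier (alg_center A)"
proof -
  have "dv \<delta> \<otimes> a = a \<otimes> dv \<delta>" if a: "a \<in> carrier A" for a
  proof (rule nondegenerate_eqI)
    fix c assume c: "c \<in> carrier A"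
    have "tr (c \<otimes> (dv \<delta> \<otimes> a)) = tr (a \<otimes> c \<otimes> dv \<delta>)"
      using tr_comm[of a "c \<otimes> dv \<delta>"] assms a c by (simp add: m_assoc)
    also have "\<dots> = tr (\<delta> (a \<otimes> c))"
      using assms a c by (simp add: tr_dv[OF assms])
    also have "\<dots> = tr (\<delta> (c \<otimes> a))"
      using assms a c tr_comm[of "\<delta> a" c] tr_comm[of a "\<delta> c"] by (simp add: Der_mult tr_add)
    also have "\<dots> = tr (c \<otimes> (a \<otimes> dv \<delta>))"
      using assms a c by (simp add: tr_dv[OF assms] m_assoc)
    finally show "tr (c \<otimes> (dv \<delta> \<otimes> a)) = tr (c \<otimes> (a \<otimes> dv \<delta>))" .
  qed (use assms a in simp_all)
  then show ?thesis
    using assms by (simp add: alg_center_def)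
qed

lemma dv_add:
  assumes "\<delta> \<in> carrier (Der A)" "\<epsilon> \<in> carrier (Der A)"
  shows "dv (\<delta> \<oplus>\<^bsub>Der A\<^esub> \<epsilon>) = dv \<delta> \<oplus> dv \<epsilon>"
  by (rule dv_eqI)
    (use assms in \<open>simp_all add: Der_add_in\<close>, use assms in \<open>simp add: Der_simps tr_add tr_dv[OF
        assms(1)] tr_dv[OF assms(2)] r_distr\<close>)

lemma dv_smult:
  assumes "\<delta> \<in> carrier (Der A)"
  shows "dv (c \<odot>\<^bsub>Der A\<^esub> \<delta>) = c \<odot> dv \<delta>"
  by (rule dv_eqI)
    (use assms in \<open>simp_all add: Der_smult_in\<close>, use assms in \<open>simp add: Der_simps tr_smult
        tr_dv[OF assms] mult_smult_right\<close>)

text \<open>The trace vanishes on commutators, hence on all values of \<open>ad a\<close>.\<close>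

lemma dv_ad: "a \<in> carrier A \<Longrightarrow> dv (ad a) = \<zero>"
  by (rule dv_eqI)
    (simp_all add: ad_in_Der, simp add: ad_def tr_diff tr_comm[of a] functional_zero[OF tr_linear])

text \<open>Integrating \<open>c \<otimes> \<delta> (dv \<epsilon>)\<close> and
  \<open>c \<otimes> \<epsilon> (dv \<delta>)\<close> by parts yields the traces of
  \<open>\<epsilon> c \<otimes> dv \<delta>\<close> and
  \<open>\<delta> c \<otimes> dv \<epsilon>\<close>, together with two terms containing both
  divergences. These two cancel because divergences commute.\<close>

lemma dv_bracket:
  assumes "\<delta> \<in> carrier (Der A)" "\<epsilon> \<in> carrier (Der A)"
  shows "dv (lie_bracket (Der A) \<delta> \<epsilon>) = \<delta> (dv \<epsilon>) \<ominus> \<epsilon> (dv \<delta>)"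
proof (rule dv_eqI)
  fix c assume c: "c \<in> carrier A"
  have comm: "dv \<delta> \<otimes> dv \<epsilon> = dv \<epsilon> \<otimes> dv \<delta>"
    using dv_central[OF assms(1)] assms by (simp add: alg_center_def)
  have "c \<otimes> (\<delta> (dv \<epsilon>) \<ominus> \<epsilon> (dv \<delta>)) = c \<otimes> \<delta> (dv \<epsilon>) \<ominus> c \<otimes> \<epsilon> (dv \<delta>)"
    using assms c by (simp add: minus_eq r_distr r_minus)
  then have "tr (c \<otimes> (\<delta> (dv \<epsilon>) \<ominus> \<epsilon> (dv \<delta>))) = tr (\<epsilon> c \<otimes> dv \<delta>) - tr (\<delta> c \<otimes> dv \<epsilon>)"
    using assms c by (simp add: tr_diff Der_mult_left[OF assms(1)] Der_mult_left[OF assms(2)]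
        tr_dv[OF assms(1)] tr_dv[OF assms(2)] m_assoc comm)
  also have "\<dots> = tr (lie_bracket (Der A) \<delta> \<epsilon> c)"
    using assms c by (simp add: Der_simps tr_diff tr_dv[OF assms(1)] tr_dv[OF assms(2)])
  finally show "tr (lie_bracket (Der A) \<delta> \<epsilon> c) = tr (c \<otimes> (\<delta> (dv \<epsilon>) \<ominus> \<epsilon> (dv \<delta>)))"
    by simp
qed (use assms in \<open>simp_all add: Der_bracket_in\<close>)

section \<open>The divergence cocycle and its class\<close>

lemma div_cocycle_cls:
  assumes "\<delta> \<in> carrier (Der A)"
  shows "div_cocycle A form (cls \<delta>) = dv \<delta>"
proof -
  have "the_elem (dv ` cls \<delta>) = dv \<delta>"
    by (rule the_elem_image_cls) (use assms in \<open>simp_all add: dv_add ad_in_Der dv_ad\<close>)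
  then show ?thesis
    using assms by (simp add: div_cocycle_def HH1_simps)
qed

text \<open>Apply \<open>\<delta>\<close> to the equation
  \<open>z \<otimes> a = a \<otimes> z\<close>; the terms with \<open>\<delta> a\<close> cancel
  since \<open>z\<close> commutes with \<open>\<delta> a\<close>.\<close>

lemma Der_central:
  assumes "\<delta> \<in> carrier (Der A)" "z \<in> carrier (alg_center A)"
  shows "\<delta> z \<in> carrier (alg_center A)"
proof -
  have z: "z \<in> carrier A" and comm: "\<And>a. a \<in> carrier A \<Longrightarrow> z \<otimes> a = a \<otimes> z"
    using assms(2) by (auto simp: alg_center_def)
  have "\<delta> z \<otimes> a = a \<otimes> \<delta> z" if "a \<in> carrier A" for a
  proof -
    have "\<delta> z \<otimes> a \<oplus> z \<otimes> \<delta> a = a \<otimes> \<delta> z \<oplus> z \<otimes> \<delta> a"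
      using arg_cong[OF comm[OF that], of \<delta>] assms z that comm[of "\<delta> a"]
      by (simp add: Der_mult a_comm)
    then show ?thesis
      using assms z that by simp
  qed
  then show ?thesis
    using assms z by (simp add: alg_center_def)
qed

text \<open>The center inherits the addition of \<open>A\<close>, but its negation is a description
  of an inverse inside the smaller carrier. The two negations agree because the center is closed
  under negatives.\<close>

lemma alg_center_minus:
  assumes "y \<in> carrier (alg_center A)" "z \<in> carrier (alg_center A)"
  shows "y \<ominus>\<^bsub>alg_center A\<^esub> z = y \<ominus> z"
proof -
  have y: "y \<in> carrier A" and z: "z \<in> carrier A" "\<And>a. a \<in> carrier A \<Longrightarrow> z \<otimes> a = a \<otimes> z"
    using assms by (auto simp: alg_center_def)
  have neg: "\<ominus> z \<in> carrier (alg_center A)"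
    using z by (simp add: alg_center_def l_minus r_minus)
  have "\<ominus>\<^bsub>alg_center A\<^esub> z = \<ominus> z"
    unfolding a_inv_def[of "alg_center A"] m_inv_def
  proof (rule the_equality)
    show "\<ominus> z \<in> carrier (add_monoid (alg_center A)) \<and>
        z \<otimes>\<^bsub>add_monoid (alg_center A)\<^esub> \<ominus> z = \<one>\<^bsub>add_monoid (alg_center A)\<^esub> \<and>
        \<ominus> z \<otimes>\<^bsub>add_monoid (alg_center A)\<^esub> z = \<one>\<^bsub>add_monoid (alg_center A)\<^esub>"
      using neg z by (simp add: alg_center_def l_neg r_neg)
    show "w = \<ominus> z"
      if "w \<in> carrier (add_monoid (alg_center A)) \<and>
        z \<otimes>\<^bsub>add_monoid (alg_center A)\<^esub> w = \<one>\<^bsub>add_monoid (alg_center A)\<^esub> \<and>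
        w \<otimes>\<^bsub>add_monoid (alg_center A)\<^esub> z = \<one>\<^bsub>add_monoid (alg_center A)\<^esub>" for w
      using that z by (intro minus_equality[symmetric]) (auto simp: alg_center_def)
  qed
  then show ?thesis
    by (simp add: a_minus_def alg_center_def)
qed

theorem div_cocycle_is_cocycle:
  "div_cocycle A form \<in> carrier (CE_cocycles1 (HH1 A) (alg_center A) HH1_act)"
proof -
  have ops: "add (alg_center A) = add A" "module.smult (alg_center A) = module.smult A"
    by (simp_all add: alg_center_def)
  have "div_cocycle A form \<in> linear_maps (HH1 A) (alg_center A)"
    unfolding linear_maps_def
  proof (intro CollectI conjI ballI allI)
    have "div_cocycle A form S \<in> carrier (alg_center A)" if "S \<in> carrier (HH1 A)" for S
      using that by (auto simp: HH1_simps div_cocycle_cls dv_central)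
    moreover have "div_cocycle A form \<in> extensional (carrier (HH1 A))"
      by (simp add: div_cocycle_def)
    ultimately show "div_cocycle A form \<in> carrier (HH1 A) \<rightarrow>\<^sub>E carrier (alg_center A)"
      by (auto simp: PiE_def)
    show "div_cocycle A form (S \<oplus>\<^bsub>HH1 A\<^esub> T)
        = div_cocycle A form S \<oplus>\<^bsub>alg_center A\<^esub> div_cocycle A form T"
      if "S \<in> carrier (HH1 A)" "T \<in> carrier (HH1 A)" for S T
      using that by (auto simp: HH1_simps(1) HH1_add div_cocycle_cls dv_add Der_add_in ops)
    show "div_cocycle A form (c \<odot>\<^bsub>HH1 A\<^esub> S) = c \<odot>\<^bsub>alg_center A\<^esub> div_cocycle A form S"
      if "S \<in> carrier (HH1 A)" for c S
      using that by (auto simp: HH1_simps(1) HH1_smult div_cocycle_cls dv_smult Der_smult_in ops)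
  qed
  moreover have "div_cocycle A form (lie_bracket (HH1 A) S T)
      = HH1_act S (div_cocycle A form T) \<ominus>\<^bsub>alg_center A\<^esub> HH1_act T (div_cocycle A form S)"
    if "S \<in> carrier (HH1 A)" "T \<in> carrier (HH1 A)" for S T
    using that
    by (auto simp: HH1_simps(1) HH1_bracket div_cocycle_cls dv_bracket Der_bracket_in
        HH1_act_cls dv_central alg_center_minus Der_central)
  ultimately show ?thesis
    by (simp add: CE_cocycles1_def)
qed

theorem Div_class_in_H1:
  "Div_class A form \<in> carrier (CE_H1 (HH1 A) (alg_center A) HH1_act)"
  unfolding Div_class_def CE_class1_def CE_H1_def quotient_space_def A_RCOSETS_def'
      partial_object.simps
  by (rule UN_I[OF div_cocycle_is_cocycle singletonI])

text \<open>One derivation suffices as a witness: if the coset of the cocycle were the set of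
  coboundaries, the cocycle, lying in its own coset, would be the coboundary of some central
  \<open>m\<close>, and evaluation at the class of \<open>\<delta>\<close> would give
  \<open>dv \<delta> = \<delta> m\<close>.\<close>

theorem Div_class_nonzero:
  assumes \<delta>: "\<delta> \<in> carrier (Der A)"
    and "\<And>m. m \<in> carrier (alg_center A) \<Longrightarrow> dv \<delta> \<noteq> \<delta> m"
  shows "Div_class A form \<noteq> \<zero>\<^bsub>CE_H1 (HH1 A) (alg_center A) HH1_act\<^esub>"
proof
  let ?Z = "CE_cocycles1 (HH1 A) (alg_center A) HH1_act"
  let ?B = "CE_coboundaries1 (HH1 A) (alg_center A) HH1_act"
  let ?f = "div_cocycle A form"
  assume "Div_class A form = \<zero>\<^bsub>CE_H1 (HH1 A) (alg_center A) HH1_act\<^esub>"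
  then have B: "?B +>\<^bsub>?Z\<^esub> ?f = ?B"
    by (simp add: Div_class_def CE_class1_def CE_H1_def quotient_space_def)
  have center: "\<zero> \<in> carrier (alg_center A)" "add (alg_center A) = add A"
    by (simp_all add: alg_center_def)
  \<comment> \<open>The coboundary of \<open>\<zero>\<close> is the zero map, so adding it exhibits
    the cocycle as a member of its own coset.\<close>
  have zero_add: "(\<lambda>S\<in>carrier (HH1 A). HH1_act S \<zero>) \<oplus>\<^bsub>?Z\<^esub> ?f = ?f"
  proof (rule ext)
    show "((\<lambda>S\<in>carrier (HH1 A). HH1_act S \<zero>) \<oplus>\<^bsub>?Z\<^esub> ?f) S = ?f S" for S
    proof (cases "S \<in> carrier (HH1 A)")
      case True
      then show ?thesis
        using center
            by (auto simp: CE_cocycles1_def HH1_simps(1) HH1_act_cls Der_at_zero div_cocycle_cls)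
    qed (simp add: CE_cocycles1_def div_cocycle_def)
  qed
  have zero_in: "(\<lambda>S\<in>carrier (HH1 A). HH1_act S \<zero>) \<in> ?B"
    unfolding CE_coboundaries1_def using center(1) by (rule imageI)
  have "?f \<in> ?B +>\<^bsub>?Z\<^esub> ?f"
    unfolding a_r_coset_def' by (rule UN_I[OF zero_in]) (simp only: zero_add singleton_iff)
  then have "?f \<in> ?B"
    using B by simp
  then obtain m where m: "m \<in> carrier (alg_center A)" "?f = (\<lambda>S\<in>carrier (HH1 A). HH1_act S m)"
    unfolding CE_coboundaries1_def by (rule imageE)
  have "dv \<delta> = ?f (cls \<delta>)"
    using \<delta> by (simp add: div_cocycle_cls)
  also have "\<dots> = \<delta> m"
    unfolding m(2) using \<delta> m(1) by (simp add: HH1_simps(1) HH1_act_cls)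
  finally show False
    using assms(2)[OF m(1)] by contradiction
qed

end

section \<open>The exterior algebra as a quotient of the free algebra\<close>

lemma single_word_mult:
  "Poly_Mapping.single (Word u) a * Poly_Mapping.single (Word v) b
    = Poly_Mapping.single (Word (u @ v)) (a * b)"
  by (simp add: mult_single plus_free_monoid_def)

lemma scalar_single:
  "Poly_Mapping.single 0 c * Poly_Mapping.single w d = Poly_Mapping.single w (c * d)"
  "Poly_Mapping.single w d * Poly_Mapping.single 0 c = Poly_Mapping.single w (d * c)"
  for w :: "'a::monoid_add"
  by (simp_all add: mult_single)

lemma poly_mapping_additive_induct [case_names single add]:
  assumes single: "\<And>k c. P (Poly_Mapping.single k c)"
    and add: "\<And>p q. \<lbrakk>P p; P q\<rbrakk> \<Longrightarrow> P (p + q)"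
  shows "P p"
proof (induction p rule: update_induct)
  case const
  then show ?case
    \<comment> \<open>The zero polynomial is a term with coefficient 0 at an arbitrary key.\<close>
    using single[of undefined 0] by simp
next
  case (update f a b)
  have "Poly_Mapping.update a b f = f + Poly_Mapping.single a b"
    using update.hyps
    by (intro poly_mapping_eqI)
      (auto simp: lookup_update lookup_add lookup_single in_keys_iff when_def)
  then show ?case
    using update.IH single add by simp
qed

text \<open>Reduces statements that are linear in \<open>p\<close> to words with coefficient 1; it
  is used below for every linear identity on the free algebra.\<close>

lemma free_algebra_induct [case_names word add scale]:
  fixes p :: "('k::field, 'v) free_algebra"
  assumes word: "\<And>w. P (Poly_Mapping.single (Word w) 1)"
    and add: "\<And>p q. \<lbrakk>P p; P q\<rbrakk> \<Longrightarrow> P (p + q)"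
    and scale: "\<And>c p. P p \<Longrightarrow> P (free_scalar c * p)"
  shows "P p"
proof (induction p rule: poly_mapping_additive_induct)
  case (single k c)
  show ?case
    using scale[OF word[of "letters k"], of c] by (simp add: scalar_single)
qed (rule add)

lemma free_scalar_commute: "p * free_scalar c = free_scalar c * p"
proof (induction p rule: poly_mapping_additive_induct)
  case (single k d)
  then show ?case by (simp add: scalar_single mult.commute)
qed (simp add: algebra_simps)

lemma free_scalar_left_commute: "p * (free_scalar c * q) = free_scalar c * (p * q)"
  by (metis free_scalar_commute mult.assoc)

lemma free_scalar_mult: "free_scalar c * free_scalar d = free_scalar (c * d)"
  by (simp add: mult_single)

lemma vector_space_free_algebra:
  "vector_space (\<lambda>c (p :: ('k::field, 'v) free_algebra). free_scalar c * p)"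
  by standard
    (simp_all add: distrib_left distrib_right single_add free_scalar_mult mult.assoc[symmetric])

text \<open>The scalar action \<open>s\<close> on the target is a parameter because two targets
  occur: the field, for the integral, and the free algebra itself, for the derivation.\<close>

definition lin_ext ::
    "('k::field \<Rightarrow> 'b \<Rightarrow> 'b) \<Rightarrow> ('v list \<Rightarrow> 'b::ab_group_add) \<Rightarrow> ('k, 'v) free_algebra \<Rightarrow> 'b" where
  "lin_ext s f p = (\<Sum>w\<in>Poly_Mapping.keys p. s (Poly_Mapping.lookup p w) (f (letters w)))"

context vector_space
begin

text \<open>Keys may cancel in a sum; a common finite index set for \<open>p\<close>,
  \<open>q\<close> and \<open>p + q\<close> makes additivity a termwise matter.\<close>

lemma lin_ext_superset:
  assumes "finite K" "Poly_Mapping.keys p \<subseteq> K"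
  shows "lin_ext scale f p = (\<Sum>w\<in>K. scale (Poly_Mapping.lookup p w) (f (letters w)))"
  unfolding lin_ext_def using assms
  by (intro sum.mono_neutral_left) (auto simp: in_keys_iff)

lemma lin_ext_add: "lin_ext scale f (p + q) = lin_ext scale f p + lin_ext scale f q"
proof -
  let ?K = "Poly_Mapping.keys p \<union> Poly_Mapping.keys q"
  have *: "finite ?K" "Poly_Mapping.keys p \<subseteq> ?K" "Poly_Mapping.keys q \<subseteq> ?K"
    "Poly_Mapping.keys (p + q) \<subseteq> ?K"
    by (auto simp: keys_add[THEN subsetD] dest: keys_add[THEN subsetD])
  show ?thesis
    by (simp add: lin_ext_superset[OF *(1,2)] lin_ext_superset[OF *(1,3)] lin_ext_superset[OF
        *(1,4)]
        lookup_add scale_left_distrib sum.distrib)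
qed

lemma lin_ext_single: "lin_ext scale f (Poly_Mapping.single (Word w) c) = scale c (f w)"
  by (cases "c = 0") (simp_all add: lin_ext_def)

lemma lin_ext_scale: "lin_ext scale f (free_scalar c * p) = scale c (lin_ext scale f p)"
proof (induction p rule: poly_mapping_additive_induct)
  case (single k d)
  obtain w where "k = Word w" by (cases k)
  then show ?case by (simp add: scalar_single lin_ext_single)
next
  case (add p q)
  then show ?case by (simp add: distrib_left lin_ext_add scale_right_distrib)
qed

end

section \<open>The ideal of relations\<close>

lemma free_ring_simps [simp]:
  "carrier free_ring = UNIV"
  "monoid.mult free_ring = (*)" "add free_ring = (+)" "zero free_ring = 0" "one free_ring = 1"
  by (simp_all add: ring_of_type_algebra_def)

lemma ring_free_ring: "ring free_ring"
proof (rule ringI)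
  show "abelian_group free_ring"
    by (rule abelian_groupI) (auto simp: algebra_simps intro: exI[of _ "- x" for x] left_minus)
  show "Group.monoid free_ring"
    by (rule monoidI) (auto simp: mult.assoc)
qed (auto simp: algebra_simps)

lemma free_ring_minus: "\<ominus>\<^bsub>free_ring\<^esub> p = - p"
proof -
  interpret ring free_ring by (rule ring_free_ring)
  show ?thesis
    using minus_equality[of "- p" p] by simp
qed

text \<open>Closure under negation comes from multiplication by \<open>-1\<close>.\<close>

lemma ideal_free_ringI:
  assumes "0 \<in> J" "\<And>p q. \<lbrakk>p \<in> J; q \<in> J\<rbrakk> \<Longrightarrow> p + q \<in> J"
    and "\<And>a p. p \<in> J \<Longrightarrow> a * p \<in> J" "\<And>a p. p \<in> J \<Longrightarrow> p * a \<in> J"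
  shows "ideal J free_ring"
proof (rule idealI[OF ring_free_ring])
  interpret ring free_ring by (rule ring_free_ring)
  show "subgroup J (add_monoid free_ring)"
  proof (rule group.subgroupI[OF a_group])
    show "inv\<^bsub>add_monoid free_ring\<^esub> p \<in> J" if "p \<in> J" for p
      using assms(3)[OF that, of "-1"] free_ring_minus[of p] by (simp add: a_inv_def)
  qed (use assms in auto)
qed (use assms in auto)

context
  fixes scale :: "'k::field \<Rightarrow> 'v::ab_group_add \<Rightarrow> 'v"
begin

lemma ideal_ext_ideal: "ideal (ext_ideal scale) free_ring"
  unfolding ext_ideal_def by (rule ring.genideal_ideal[OF ring_free_ring]) simp

lemma ext_relation_in_ideal: "r \<in> ext_relations scale \<Longrightarrow> r \<in> ext_ideal scale"
  unfolding ext_ideal_def using ring.genideal_self[OF ring_free_ring, of "ext_relations scale"] by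
      auto

text \<open>The induction principle for the ideal: a property is inherited from the relations once
  the set where it holds is a two-sided ideal.\<close>

lemma ext_ideal_minimal:
  assumes "0 \<in> J" "\<And>p q. \<lbrakk>p \<in> J; q \<in> J\<rbrakk> \<Longrightarrow> p + q \<in> J"
    and "\<And>a p. p \<in> J \<Longrightarrow> a * p \<in> J" "\<And>a p. p \<in> J \<Longrightarrow> p * a \<in> J"
    and "ext_relations scale \<subseteq> J"
  shows "ext_ideal scale \<subseteq> J"
  unfolding ext_ideal_def
  using ring.genideal_minimal[OF ring_free_ring ideal_free_ringI[OF assms(1-4)] assms(5)] .

lemma ext_ideal_zero: "0 \<in> ext_ideal scale"
  using additive_subgroup.zero_closed[OF ideal.axioms(1)[OF ideal_ext_ideal]] by simp

lemma ext_ideal_add: "\<lbrakk>p \<in> ext_ideal scale; q \<in> ext_ideal scale\<rbrakk> \<Longrightarrow> p + q \<in> ext_ideal scale"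
  using additive_subgroup.a_closed[OF ideal.axioms(1)[OF ideal_ext_ideal], of p q] by simp

lemma ext_ideal_mult_left: "p \<in> ext_ideal scale \<Longrightarrow> a * p \<in> ext_ideal scale"
  using ideal.I_l_closed[OF ideal_ext_ideal, of p a] by simp

lemma ext_ideal_mult_right: "p \<in> ext_ideal scale \<Longrightarrow> p * a \<in> ext_ideal scale"
  using ideal.I_r_closed[OF ideal_ext_ideal, of p a] by simp

lemma ext_ideal_uminus: "p \<in> ext_ideal scale \<Longrightarrow> - p \<in> ext_ideal scale"
  using ext_ideal_mult_left[of p "-1"] by simp

lemma ext_ideal_diff: "\<lbrakk>p \<in> ext_ideal scale; q \<in> ext_ideal scale\<rbrakk> \<Longrightarrow> p - q \<in> ext_ideal scale"
  using ext_ideal_add[of p "- q"] ext_ideal_uminus by simp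

lemma ext_proj_def': "ext_proj scale p = {i + p | i. i \<in> ext_ideal scale}"
  by (auto simp: ext_proj_def a_r_coset_def')

lemma ext_proj_mem: "q \<in> ext_proj scale p \<longleftrightarrow> q - p \<in> ext_ideal scale"
  unfolding ext_proj_def' by (auto intro: exI[of _ "q - p"])

lemma ext_proj_eq_iff: "ext_proj scale p = ext_proj scale q \<longleftrightarrow> p - q \<in> ext_ideal scale"
proof
  assume "ext_proj scale p = ext_proj scale q"
  moreover have "p \<in> ext_proj scale p"
    by (simp add: ext_proj_mem ext_ideal_zero)
  ultimately show "p - q \<in> ext_ideal scale"
    by (simp add: ext_proj_mem)
next
  assume *: "p - q \<in> ext_ideal scale"
  show "ext_proj scale p = ext_proj scale q"
  proof (rule Set.set_eqI)
    show "r \<in> ext_proj scale p \<longleftrightarrow> r \<in> ext_proj scale q" for r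
      using ext_ideal_add[OF _ *, of "r - p"] ext_ideal_diff[OF _ *, of "r - q"]
      by (auto simp: ext_proj_mem)
  qed
qed

section \<open>Operations of the exterior algebra on representatives\<close>

lemma ext_carrier: "carrier (exterior_algebra scale) = range (ext_proj scale)"
  by (auto simp: exterior_algebra_def ring.defs FactRing_def A_RCOSETS_def' ext_proj_def)

lemma ext_proj_in [simp]: "ext_proj scale p \<in> carrier (exterior_algebra scale)"
  by (simp add: ext_carrier)

lemma ext_add:
  "ext_proj scale p \<oplus>\<^bsub>exterior_algebra scale\<^esub> ext_proj scale q = ext_proj scale (p + q)"
  using abelian_subgroup.a_rcos_sum[OF ideal.axioms(1)[OF ideal_ext_ideal, THEN abelian_subgroupI3]]
    ring.is_abelian_group[OF ring_free_ring]
  by (simp add: exterior_algebra_def ring.defs FactRing_def ext_proj_def)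

lemma ext_mult:
  "ext_proj scale p \<otimes>\<^bsub>exterior_algebra scale\<^esub> ext_proj scale q = ext_proj scale (p * q)"
  using ideal.rcoset_mult_add[OF ideal_ext_ideal, of p q]
  by (simp add: exterior_algebra_def ring.defs FactRing_def ext_proj_def)

lemma ext_one: "\<one>\<^bsub>exterior_algebra scale\<^esub> = ext_proj scale 1"
  by (simp add: exterior_algebra_def ring.defs FactRing_def ext_proj_def)

lemma ext_zero: "\<zero>\<^bsub>exterior_algebra scale\<^esub> = ext_proj scale 0"
  by (simp add: exterior_algebra_def ring.defs FactRing_def ext_proj_def')

lemma ext_smult:
  "c \<odot>\<^bsub>exterior_algebra scale\<^esub> ext_proj scale p = ext_proj scale (free_scalar c * p)"
  using ideal.rcoset_mult_add[OF ideal_ext_ideal, of "free_scalar c" p]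
  by (simp add: exterior_algebra_def ring.defs FactRing_def ext_proj_def)

lemma ring_exterior_algebra: "ring (exterior_algebra scale)"
proof (rule ringI)
  show "abelian_group (exterior_algebra scale)"
  proof (rule abelian_groupI)
    show "\<exists>b\<in>carrier (exterior_algebra scale). b \<oplus>\<^bsub>exterior_algebra scale\<^esub> a
        = \<zero>\<^bsub>exterior_algebra scale\<^esub>"
      if a: "a \<in> carrier (exterior_algebra scale)" for a
    proof -
      obtain p where "a = ext_proj scale p"
        using a by (auto simp: ext_carrier)
      then show ?thesis
        by (intro bexI[of _ "ext_proj scale (- p)"]) (simp_all add: ext_add ext_zero)
    qed
  qed (auto simp: ext_carrier ext_add ext_zero algebra_simps)
  show "Group.monoid (exterior_algebra scale)"
    by (rule monoidI) (auto simp: ext_carrier ext_mult ext_one mult.assoc)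
qed (auto simp: ext_carrier ext_add ext_mult algebra_simps)

lemma wedge_eq: "wedge scale vs = ext_proj scale (Poly_Mapping.single (Word vs) 1)"
proof (induction vs)
  case Nil
  show ?case
    using single_one by (simp add: wedge_def ext_one zero_free_monoid_def[symmetric])
next
  case (Cons v vs)
  then show ?case
    by (simp add: wedge_def ext_mult single_word_mult)
qed

end

section \<open>Calculus with words modulo the relations\<close>

context
  fixes scale :: "'k::field \<Rightarrow> 'v::ab_group_add \<Rightarrow> 'v"
begin

text \<open>Identities of the exterior algebra are derived as chains of equal classes of
  free-algebra elements; this congruence and the next allow replacement inside sums and
  products.\<close>

lemma ext_proj_add_cong:
  "\<lbrakk>ext_proj scale p = ext_proj scale p'; ext_proj scale q = ext_proj scale q'\<rbrakk>
    \<Longrightarrow> ext_proj scale (p + q) = ext_proj scale (p' + q')"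
  by (metis ext_add)

lemma ext_proj_mult_cong:
  "\<lbrakk>ext_proj scale p = ext_proj scale p'; ext_proj scale q = ext_proj scale q'\<rbrakk>
    \<Longrightarrow> ext_proj scale (p * q) = ext_proj scale (p' * q')"
  by (metis ext_mult)

lemma gen_add: "ext_proj scale (free_gen (v + w)) = ext_proj scale (free_gen v + free_gen w)"
  unfolding ext_proj_eq_iff
  by (rule ext_relation_in_ideal) (auto simp: ext_relations_def)

lemma gen_scale: "ext_proj scale (free_gen (scale c v))
    = ext_proj scale (free_scalar c * free_gen v)"
  unfolding ext_proj_eq_iff
  by (rule ext_relation_in_ideal) (auto simp: ext_relations_def)

lemma gen_square: "ext_proj scale (free_gen v * free_gen v) = ext_proj scale 0"
  unfolding ext_proj_eq_iff diff_zero
  by (rule ext_relation_in_ideal) (auto simp: ext_relations_def)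

text \<open>Polarization: expand the square of \<open>v + w\<close> and remove the squares of
  \<open>v\<close> and of \<open>w\<close>.\<close>

lemma gen_anticommute: "ext_proj scale (free_gen v * free_gen w)
    = ext_proj scale (- (free_gen w * free_gen v))"
proof -
  let ?s = "(free_gen v + free_gen w) :: ('k, 'v) free_algebra"
  have "ext_proj scale (?s * ?s) = ext_proj scale (free_gen (v + w) * free_gen (v + w))"
    using gen_add[of v w] by (intro ext_proj_mult_cong) simp_all
  then have "?s * ?s \<in> ext_ideal scale"
    using gen_square[of "v + w"] by (simp add: ext_proj_eq_iff[of scale _ 0, simplified])
  moreover have "free_gen v * free_gen v \<in> ext_ideal scale" "free_gen w * free_gen w \<in> ext_ideal
      scale"
    using gen_square[of v] gen_square[of w] by (simp_all add: ext_proj_eq_iff)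
  ultimately have "?s * ?s - free_gen v * free_gen v - free_gen w * free_gen w \<in> ext_ideal scale"
    by (intro ext_ideal_diff)
  moreover have "?s * ?s - free_gen v * free_gen v - free_gen w * free_gen w
      = free_gen v * free_gen w - (- (free_gen w * free_gen v))"
    by (simp add: distrib_left distrib_right)
  ultimately show ?thesis
    by (simp add: ext_proj_eq_iff)
qed

text \<open>The zero vector is a nonzero letter of the free algebra; the additivity relation for
  \<open>0 + 0\<close> puts it into the ideal.\<close>

lemma gen_zero: "ext_proj scale (free_gen 0) = ext_proj scale 0"
  using gen_add[of 0 0] ext_ideal_uminus[of "- free_gen 0" scale]
  by (simp add: ext_proj_eq_iff)

lemma gen_sum:
  "finite B \<Longrightarrow> ext_proj scale (free_gen (\<Sum>b\<in>B. scale (c b) b))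
    = ext_proj scale (\<Sum>b\<in>B. free_scalar (c b) * free_gen b)"
proof (induction B rule: finite_induct)
  case (insert b B)
  then show ?case
    using gen_add[of "scale (c b) b" "\<Sum>b\<in>B. scale (c b) b"]
      ext_proj_add_cong[OF gen_scale[of "c b" b] insert.IH] by simp
qed (simp add: gen_zero)

lemma word_Cons: "Poly_Mapping.single (Word (a # u)) 1
    = (free_gen a * Poly_Mapping.single (Word u) 1 :: ('k, 'v) free_algebra)"
  by (simp add: single_word_mult)

text \<open>The letter \<open>a\<close> passes the letters of \<open>u\<close> one by one, each
  exchange contributing a sign by anticommutativity.\<close>

lemma word_rotate1:
  "ext_proj scale (Poly_Mapping.single (Word (u @ [a])) 1)
    = ext_proj scale (free_scalar ((-1) ^ length u) * Poly_Mapping.single (Word (a # u)) 1)"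
proof (induction u)
  case Nil
  then show ?case by simp
next
  case (Cons b u)
  let ?W = "\<lambda>w. Poly_Mapping.single (Word w) 1 :: ('k, 'v) free_algebra"
  let ?s = "free_scalar ((-1) ^ length u) :: ('k, 'v) free_algebra"
  have "ext_proj scale (?W ((b # u) @ [a])) = ext_proj scale (free_gen b * ?W (u @ [a]))"
    by (simp add: single_word_mult)
  also have "\<dots> = ext_proj scale (free_gen b * (?s * ?W (a # u)))"
    by (intro ext_proj_mult_cong Cons.IH refl)
  also have "\<dots> = ext_proj scale (?s * ((free_gen b * free_gen a) * ?W u))"
    by (simp add: free_scalar_left_commute[of "free_gen b"] single_word_mult)
  also have "\<dots> = ext_proj scale (?s * ((- (free_gen a * free_gen b)) * ?W u))"
    by (intro ext_proj_mult_cong gen_anticommute refl)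
  also have "?s * ((- (free_gen a * free_gen b)) * ?W u)
      = free_scalar ((-1) ^ length (b # u)) * ?W (a # b # u)"
    by (simp add: single_word_mult single_uminus)
  finally show ?case .
qed

lemma word_move_front:
  "ext_proj scale (Poly_Mapping.single (Word (u @ a # v)) 1)
    = ext_proj scale (free_scalar ((-1) ^ length u) * Poly_Mapping.single (Word (a # u @ v)) 1)"
proof -
  have "ext_proj scale (Poly_Mapping.single (Word (u @ [a])) 1 * Poly_Mapping.single (Word v) 1)
    = ext_proj scale ((free_scalar ((-1) ^ length u) * Poly_Mapping.single (Word (a # u)) 1)
        * Poly_Mapping.single (Word v) 1)"
    by (intro ext_proj_mult_cong word_rotate1 refl)
  then show ?thesis
    by (simp add: single_word_mult mult.assoc)
qed

text \<open>The first letter of \<open>w\<close> is located in \<open>w'\<close> and brought to the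
  front, then the remaining words are compared. The sign is left unspecified, since later only its
  being 1 or -1 matters.\<close>

lemma word_mset:
  "mset w = mset w' \<Longrightarrow> \<exists>s\<in>{1, -1}. ext_proj scale (Poly_Mapping.single (Word w) 1)
    = ext_proj scale (free_scalar s * Poly_Mapping.single (Word w') 1)"
proof (induction w arbitrary: w')
  case Nil
  then show ?case by simp
next
  case (Cons a w)
  then obtain u v where w': "w' = u @ a # v"
    by (metis list.set_intros(1) mset_eq_setD split_list)
  then have "mset w = mset (u @ v)"
    using Cons.prems by simp
  then obtain s where s: "s \<in> {1, -1}" "ext_proj scale (Poly_Mapping.single (Word w) 1)
      = ext_proj scale (free_scalar s * Poly_Mapping.single (Word (u @ v)) 1)"
    using Cons.IH by blast
  let ?t = "(-1) ^ length u :: 'k"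
  have t: "?t * ?t = 1" "?t \<in> {1, -1}"
    by (auto simp: power_mult_distrib[symmetric] minus_one_power_iff)
  have "ext_proj scale (Poly_Mapping.single (Word (a # w)) 1)
      = ext_proj scale (free_gen a * (free_scalar s * Poly_Mapping.single (Word (u @ v)) 1))"
    unfolding word_Cons[of a w] by (intro ext_proj_mult_cong s refl)
  \<comment> \<open>The sign \<open>?t\<close> squares to 1, so it is inserted twice; one copy is
    absorbed when \<open>a\<close> moves back behind \<open>u\<close>.\<close>
  also have "\<dots> = ext_proj scale (free_scalar (s * ?t)
      * (free_scalar ?t * Poly_Mapping.single (Word (a # u @ v)) 1))"
    using t by (simp add: free_scalar_left_commute[of "free_gen a"] single_word_mult scalar_single
        mult.assoc)
  also have "\<dots> = ext_proj scale (free_scalar (s * ?t) * Poly_Mapping.single (Word w') 1)"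
    unfolding w' by (intro ext_proj_mult_cong word_move_front[symmetric] refl)
  finally show ?case
    using s(1) t(2) by (intro bexI[of _ "s * ?t"]) auto
qed

text \<open>Reordering brings the two equal letters to the front, where they form a square.\<close>

lemma word_not_distinct:
  assumes "\<not> distinct w"
  shows "ext_proj scale (Poly_Mapping.single (Word w) 1) = ext_proj scale 0"
proof -
  obtain u a v z where "w = u @ [a] @ v @ [a] @ z"
    using not_distinct_decomp[OF assms] by blast
  then have "mset w = mset (a # a # u @ v @ z)"
    by simp
  then obtain s where "ext_proj scale (Poly_Mapping.single (Word w) 1)
      = ext_proj scale (free_scalar s * Poly_Mapping.single (Word (a # a # u @ v @ z)) 1)"
    using word_mset by blast
  also have "free_scalar s * Poly_Mapping.single (Word (a # a # u @ v @ z)) 1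
      = free_scalar s * ((free_gen a * free_gen a) * (Poly_Mapping.single (Word (u @ v @ z)) 1 ::
          ('k, 'v) free_algebra))"
    by (simp add: single_word_mult)
  also have "ext_proj scale \<dots>
      = ext_proj scale (free_scalar s * (0 * Poly_Mapping.single (Word (u @ v @ z)) 1))"
    by (intro ext_proj_mult_cong gen_square refl)
  finally show ?thesis
    by simp
qed

end

text \<open>The map induced by \<open>g\<close> on the quotient, meaningful once \<open>g\<close> is
  constant on classes. The restriction to the carrier makes it extensional, as
  \<open>linear_maps\<close> demands.\<close>

definition lift_proj_fun :: "('k::field \<Rightarrow> 'v::ab_group_add \<Rightarrow> 'v) \<Rightarrow> (('k, 'v) free_algebra \<Rightarrow> 'b)
    \<Rightarrow> ('k, 'v) free_algebra set \<Rightarrow> 'b" where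
  "lift_proj_fun scale g = (\<lambda>S\<in>carrier (exterior_algebra scale). g (SOME p. S = ext_proj scale p))"

lemma lift_proj_fun_proj:
  assumes "\<And>p q. p - q \<in> ext_ideal scale \<Longrightarrow> g p = g q"
  shows "lift_proj_fun scale g (ext_proj scale p) = g p"
proof -
  have "ext_proj scale p = ext_proj scale (SOME q. ext_proj scale p = ext_proj scale q)"
    by (rule someI) (rule refl)
  then have "g p = g (SOME q. ext_proj scale p = ext_proj scale q)"
    by (intro assms) (simp add: ext_proj_eq_iff[symmetric])
  then show ?thesis
    by (simp add: lift_proj_fun_def)
qed

section \<open>Monomials and the determinant\<close>

text \<open>The space \<open>V\<close> is the whole type \<open>'v\<close> and \<open>set xs\<close>
  is its basis; distinctness makes the list an ordered basis, of length the dimension.\<close>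

locale ext_basis = finite_dimensional_vector_space scale "set xs"
  for scale :: "'k::field \<Rightarrow> 'v::ab_group_add \<Rightarrow> 'v" and xs :: "'v list" +
  assumes distinct_xs: "distinct xs"
begin

abbreviation "n \<equiv> length xs"
abbreviation (input) "W w \<equiv> Poly_Mapping.single (Word w) (1::'k)"
abbreviation "coord b v \<equiv> representation (set xs) v b"

definition monom :: "'v set \<Rightarrow> ('k, 'v) free_algebra" where
  "monom T = W (filter (\<lambda>x. x \<in> T) xs)"

lemma coord_add: "coord b (v + w) = coord b v + coord b w"
  using representation_add[OF independent_Basis] by (simp add: span_Basis)

lemma coord_scale: "coord b (scale c v) = c * coord b v"
  using representation_scale[OF independent_Basis] by (simp add: span_Basis)

lemma coord_basis: "a \<in> set xs \<Longrightarrow> coord b a = (if b = a then 1 else 0)"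
  using representation_basis[OF independent_Basis] by simp

lemma sum_coord: "(\<Sum>b\<in>set xs. scale (coord b v) b) = v"
  by (rule sum_representation_eq) (simp_all add: independent_Basis span_Basis)

section \<open>The monomials span the exterior algebra\<close>

definition spanned :: "('k, 'v) free_algebra \<Rightarrow> bool" where
  "spanned p \<longleftrightarrow> (\<exists>c. ext_proj scale p
      = ext_proj scale (\<Sum>T\<in>Pow (set xs). free_scalar (c T) * monom T))"

lemma spanned_cong: "\<lbrakk>ext_proj scale p = ext_proj scale q; spanned q\<rbrakk> \<Longrightarrow> spanned p"
  by (simp add: spanned_def)

lemma spanned_add:
  assumes "spanned p" "spanned q"
  shows "spanned (p + q)"
proof -
  obtain c d where
    "ext_proj scale p = ext_proj scale (\<Sum>T\<in>Pow (set xs). free_scalar (c T) * monom T)"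
    "ext_proj scale q = ext_proj scale (\<Sum>T\<in>Pow (set xs). free_scalar (d T) * monom T)"
    using assms by (auto simp: spanned_def)
  from ext_proj_add_cong[OF this]
  have "ext_proj scale (p + q)
      = ext_proj scale (\<Sum>T\<in>Pow (set xs). free_scalar (c T + d T) * monom T)"
    by (simp add: single_add distrib_right sum.distrib)
  then show ?thesis
    by (auto simp: spanned_def)
qed

lemma spanned_scale:
  assumes "spanned p"
  shows "spanned (free_scalar a * p)"
proof -
  obtain c where
    "ext_proj scale p = ext_proj scale (\<Sum>T\<in>Pow (set xs). free_scalar (c T) * monom T)"
    using assms by (auto simp: spanned_def)
  from ext_proj_mult_cong[OF refl this, of "free_scalar a"]
  have "ext_proj scale (free_scalar a * p)
      = ext_proj scale (\<Sum>T\<in>Pow (set xs). free_scalar (a * c T) * monom T)"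
    by (simp add: sum_distrib_left free_scalar_mult[symmetric] mult.assoc)
  then show ?thesis
    by (auto simp: spanned_def)
qed

lemma spanned_zero: "spanned 0"
  unfolding spanned_def by (rule exI[of _ "\<lambda>_. 0"]) simp

lemma spanned_sum: "(\<And>i. i \<in> S \<Longrightarrow> spanned (f i)) \<Longrightarrow> spanned (sum f S)"
  by (induction S rule: infinite_finite_induct) (auto simp: spanned_zero spanned_add)

lemma spanned_monom:
  assumes "T \<subseteq> set xs"
  shows "spanned (monom T)"
proof -
  have "(\<Sum>U\<in>Pow (set xs). free_scalar (if U = T then 1 else 0) * monom U) = monom T"
    using assms by (simp add: if_distrib[of "\<lambda>c. free_scalar c * _"] sum.delta cong: if_cong)
  then show ?thesis
    unfolding spanned_def by (intro exI[of _ "\<lambda>U. if U = T then 1 else 0"]) simp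
qed

text \<open>A word with distinct letters can be sorted into a monomial at the cost of a sign; one
  with a repeated letter vanishes.\<close>

lemma spanned_basis_word:
  assumes "set w \<subseteq> set xs"
  shows "spanned (W w)"
proof (cases "distinct w")
  case True
  then have "mset w = mset (filter (\<lambda>x. x \<in> set w) xs)"
    using assms distinct_xs by (intro set_eq_iff_mset_eq_distinct[THEN iffD1]) auto
  then obtain s where
    "ext_proj scale (W w) = ext_proj scale (free_scalar s * monom (set w))"
    using word_mset unfolding monom_def by blast
  then show ?thesis
    using assms by (rule spanned_cong[OF _ spanned_scale[OF spanned_monom]])
next
  case False
  then show ?thesis
    by (rule spanned_cong[OF word_not_distinct spanned_zero])
qed

text \<open>After expanding \<open>v\<close> in coordinates, each product of a basis vector and a
  monomial is a word in basis letters.\<close>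

lemma spanned_gen_mult:
  assumes "spanned p"
  shows "spanned (free_gen v * p)"
proof -
  obtain c where c:
    "ext_proj scale p = ext_proj scale (\<Sum>T\<in>Pow (set xs). free_scalar (c T) * monom T)"
    using assms by (auto simp: spanned_def)
  have "ext_proj scale (free_gen v)
      = ext_proj scale (\<Sum>b\<in>set xs. free_scalar (coord b v) * free_gen b)"
    using gen_sum[of "set xs" scale "\<lambda>b. coord b v"] by (simp add: sum_coord)
  from ext_proj_mult_cong[OF this c] show ?thesis
  proof (rule spanned_cong)
    have "spanned (free_scalar (coord b v) * (free_scalar (c T) * (free_gen b * monom T)))"
      if "b \<in> set xs" for b T
      using that
      by (intro spanned_scale) (auto simp: monom_def single_word_mult intro!: spanned_basis_word)
    then show "spanned ((\<Sum>b\<in>set xs. free_scalar (coord b v) * free_gen b) *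
        (\<Sum>T\<in>Pow (set xs). free_scalar (c T) * monom T))"
      by (simp add: sum_distrib_left sum_distrib_right mult.assoc free_scalar_left_commute[of
          "free_gen _"]
          spanned_sum)
  qed
qed

text \<open>Letters are arbitrary vectors, so a word is built up by left multiplication with one
  vector at a time.\<close>

lemma spanned_all: "spanned p"
proof (induction p rule: free_algebra_induct)
  case (word w)
  show ?case
  proof (induction w)
    case Nil
    then show ?case by (rule spanned_basis_word) simp
  next
    case (Cons v w)
    then show ?case
      unfolding word_Cons[of v w] by (rule spanned_gen_mult)
  qed
qed (auto intro: spanned_add spanned_scale)

section \<open>The Leibniz determinant on words of length \<open>n\<close>, extended by zero\<close>

definition word_det :: "'v list \<Rightarrow> 'k" where
  "word_det w = (if length w = n
     then \<Sum>\<pi> | \<pi> permutes {..<n}. of_int (sign \<pi>) * (\<Prod>i<n. coord (xs ! \<pi> i) (w ! i))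
     else 0)"

text \<open>Isolates the factor that depends on the letter \<open>v\<close>. The placeholder
  \<open>0\<close> makes the remaining product visibly independent of \<open>v\<close>, so
  multilinearity of the determinant is read off.\<close>

lemma prod_nth_split:
  assumes "length (u @ v # w) = n"
  shows "(\<Prod>i<n. f i ((u @ v # w) ! i))
    = f (length u) v * (\<Prod>i\<in>{..<n} - {length u}. f i ((u @ 0 # w) ! i))"
proof -
  have "(\<Prod>i<n. f i ((u @ v # w) ! i))
      = f (length u) v * (\<Prod>i\<in>{..<n} - {length u}. f i ((u @ v # w) ! i))"
    using assms by (subst prod.remove[of _ "length u"]) auto
  moreover have "(u @ v # w) ! i = (u @ 0 # w) ! i" if "i \<noteq> length u" for i
    using that by (auto simp: nth_append nth_Cons')
  ultimately show ?thesis
    by simp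
qed

lemma word_det_add: "word_det (u @ (v + v') # w) = word_det (u @ v # w) + word_det (u @ v' # w)"
proof (cases "length (u @ v # w) = n")
  case True
  then have len: "length (u @ z # w) = n" for z by simp
  show ?thesis
    unfolding word_det_def
    by (simp only: len refl if_True prod_nth_split[OF len, where f = "\<lambda>i. coord (xs ! _ i)"]
        coord_add distrib_right distrib_left sum.distrib)
qed (simp add: word_det_def)

lemma word_det_scale: "word_det (u @ scale c v # w) = c * word_det (u @ v # w)"
proof (cases "length (u @ v # w) = n")
  case True
  then have len: "length (u @ z # w) = n" for z by simp
  show ?thesis
    unfolding word_det_def
    by (simp only: len refl if_True prod_nth_split[OF len, where f = "\<lambda>i. coord (xs ! _ i)"]
        coord_scale sum_distrib_left mult_ac)
qed (simp add: word_det_def)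

text \<open>Composing with the transposition of the two equal positions flips the sign of each
  summand, so the sum equals its own negative; \<open>2 \<noteq> 0\<close> then makes it
  zero.\<close>

lemma word_det_alternating:
  assumes "(2::'k) \<noteq> 0"
  shows "word_det (u @ v # v # w) = 0"
proof (cases "length (u @ v # v # w) = n")
  case True
  let ?l = "u @ v # v # w" and ?k = "length u"
  let ?\<tau> = "Transposition.transpose ?k (Suc ?k)"
  let ?S = "\<lambda>\<pi>. of_int (sign \<pi>) * (\<Prod>i<n. coord (xs ! \<pi> i) (?l ! i)) :: 'k"
  have \<tau>: "?\<tau> permutes {..<n}"
    using True by (intro permutes_swap_id) auto
  have neg: "?S (\<pi> \<circ> ?\<tau>) = - ?S \<pi>" if "\<pi> permutes {..<n}" for \<pi>
  proof -
    have "sign (\<pi> \<circ> ?\<tau>) = - sign \<pi>"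
      using permutes_imp_permutation[OF _ that]
          by (simp add: sign_compose sign_swap_id permutation_swap_id)
    moreover have "(\<Prod>i<n. coord (xs ! (\<pi> \<circ> ?\<tau>) i) (?l ! i))
        = (\<Prod>i<n. coord (xs ! \<pi> i) (?l ! i))"
    \<comment> \<open>Swapping the two positions leaves the word unchanged, so reindexing by the
      transposition only permutes the factors.\<close>
    proof (rule prod.reindex_bij_witness[of _ ?\<tau> ?\<tau>])
      have "?l ! ?\<tau> i = ?l ! i" for i
        by (simp add: Transposition.transpose_def nth_append)
      then show "coord (xs ! \<pi> (?\<tau> i)) (?l ! ?\<tau> i) = coord (xs ! (\<pi> \<circ> ?\<tau>) i) (?l ! i)" for i
        by simp
    qed (simp_all only: permutes_in_image[OF \<tau>] transpose_involutory)
    ultimately show ?thesis by simp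
  qed
  have "(\<Sum>\<pi> | \<pi> permutes {..<n}. ?S (\<pi> \<circ> ?\<tau>)) = - (\<Sum>\<pi> | \<pi> permutes {..<n}. ?S \<pi>)"
    unfolding sum_negf[symmetric] by (rule sum.cong[OF refl], rule neg) simp
  then have "(\<Sum>\<pi> | \<pi> permutes {..<n}. ?S \<pi>) = - (\<Sum>\<pi> | \<pi> permutes {..<n}. ?S \<pi>)"
    by (rule trans[OF sum_permutations_compose_right[OF \<tau>]])
  then have "2 * (\<Sum>\<pi> | \<pi> permutes {..<n}. ?S \<pi>) = 0"
    unfolding eq_neg_iff_add_eq_0 mult_2 .
  then show ?thesis
    using assms True by (simp add: word_det_def)
qed (simp add: word_det_def)

text \<open>A permutation other than the identity moves some index and so produces a coordinate of
  one basis vector along another, which is 0.\<close>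

lemma word_det_basis: "word_det xs = 1"
proof -
  have "(\<Prod>i<n. coord (xs ! \<pi> i) (xs ! i)) = 0" if perm: "\<pi> permutes {..<n}" and "\<pi> \<noteq> id" for \<pi>
  proof -
    obtain i where "\<pi> i \<noteq> i"
      using \<open>\<pi> \<noteq> id\<close> by (auto simp: fun_eq_iff)
    then have "i < n" "\<pi> i < n"
      using permutes_not_in[OF perm, of i] permutes_in_image[OF perm, of i] by auto
    then have "coord (xs ! \<pi> i) (xs ! i) = 0"
      using \<open>\<pi> i \<noteq> i\<close> distinct_xs by (simp add: coord_basis nth_eq_iff_index_eq)
    then show ?thesis
      using \<open>i < n\<close> by (auto intro: prod_zero)
  qed
  then have "word_det xs = (\<Sum>\<pi> | \<pi> permutes {..<n}. if \<pi> = id then 1 else 0)"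
    unfolding word_det_def by (auto intro!: sum.cong simp: coord_basis)
  then show ?thesis
    by (simp add: finite_permutations)
qed

definition free_int :: "('k, 'v) free_algebra \<Rightarrow> 'k" where
  "free_int = lin_ext (*) word_det"

lemma vector_space_field: "vector_space ((*) :: 'k \<Rightarrow> 'k \<Rightarrow> 'k)"
  by standard (simp_all add: algebra_simps)

lemma free_int_add: "free_int (p + q) = free_int p + free_int q"
  and free_int_scale: "free_int (free_scalar c * p) = c * free_int p"
  and free_int_single: "free_int (Poly_Mapping.single (Word w) c) = c * word_det w"
  unfolding free_int_def
  by (rule vector_space.lin_ext_add[OF vector_space_field]
      vector_space.lin_ext_scale[OF vector_space_field]
      vector_space.lin_ext_single[OF vector_space_field])+

lemma free_int_zero: "free_int 0 = 0"
  using free_int_scale[of 0 0] by simp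

lemma free_int_diff: "free_int (p - q) = free_int p - free_int q"
  using free_int_add[of "p - q" q] by simp

lemma free_int_sum: "free_int (sum f S) = (\<Sum>i\<in>S. free_int (f i))"
  by (induction S rule: infinite_finite_induct) (simp_all add: free_int_zero free_int_add)

end

section \<open>The integral vanishes on the ideal and is a symmetric trace\<close>

locale ext_basis_odd = ext_basis scale xs
  for scale :: "'k::field \<Rightarrow> 'v::ab_group_add \<Rightarrow> 'v" and xs :: "'v list" +
  assumes two_nonzero: "(2::'k) \<noteq> 0"
    and odd_n: "odd (length xs)"
begin

text \<open>The ideal is two-sided, hence the words on both sides. The three kinds of relations
  correspond to additivity, homogeneity and the alternating property of the determinant.\<close>

lemma free_int_relation_word:
  assumes "r \<in> ext_relations scale"
  shows "free_int (W u * r * W w) = 0"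
proof -
  consider v v' where "r = free_gen (v + v') - (free_gen v + free_gen v')"
    | c v where "r = free_gen (scale c v) - free_scalar c * free_gen v"
    | v where "r = free_gen v * free_gen v"
    using assms by (auto simp: ext_relations_def)
  then show ?thesis
  proof cases
    case 1
    have "W u * r * W w = W (u @ (v + v') # w) - (W (u @ v # w) + W (u @ v' # w))"
      unfolding 1 by (simp add: ring_distribs single_word_mult)
    then show ?thesis
      by (simp only: free_int_diff free_int_add free_int_single word_det_add) simp
  next
    case 2
    have "W u * r * W w = W (u @ scale c v # w) - free_scalar c * W (u @ v # w)"
      unfolding 2 by (simp add: ring_distribs single_word_mult scalar_single)
    then show ?thesis
      by (simp only: free_int_diff free_int_scale free_int_single word_det_scale) simp
  next
    case 3
    then have "W u * r * W w = W (u @ v # v # w)"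
      by (simp add: single_word_mult)
    then show ?thesis
      by (simp only: free_int_single word_det_alternating[OF two_nonzero]) simp
  qed
qed

text \<open>The elements whose multiples from both sides all have integral zero form a two-sided
  ideal; it contains the relations, and the multiplier 1 gives the claim.\<close>

lemma free_int_ideal:
  assumes "p \<in> ext_ideal scale"
  shows "free_int p = 0"
proof -
  have "ext_ideal scale \<subseteq> {p. \<forall>a b. free_int (a * p * b) = 0}"
  proof (rule ext_ideal_minimal)
    show "ext_relations scale \<subseteq> {p. \<forall>a b. free_int (a * p * b) = 0}"
    proof clarify
      fix r a b assume r: "r \<in> ext_relations scale"
      have *: "free_int (W u * r * b) = 0" for u
      proof (induction b rule: free_algebra_induct)
        case (word w)
        show ?case by (rule free_int_relation_word[OF r])
      qed (simp_all add: distrib_left free_int_add free_scalar_left_commute free_int_scale)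
      show "free_int (a * r * b) = 0"
      proof (induction a rule: free_algebra_induct)
        case (word w)
        show ?case by (rule *)
      qed (simp_all add: distrib_right free_int_add free_int_scale mult.assoc)
    qed
  next
    fix a p assume "p \<in> {p. \<forall>a b. free_int (a * p * b) = 0}"
    then have p: "free_int (b * p * c) = 0" for b c
      by simp
    have "free_int (b * (a * p) * c) = 0" "free_int (b * (p * a) * c) = 0" for b c
      using p[of "b * a" c] p[of b "a * c"] by (simp_all add: mult.assoc)
    then show "a * p \<in> {p. \<forall>a b. free_int (a * p * b)
        = 0}" "p * a \<in> {p. \<forall>a b. free_int (a * p * b) = 0}"
      by simp_all
  qed (auto simp: free_int_zero free_int_add distrib_left distrib_right)
  then have "free_int (1 * p * 1) = 0"
    using assms by blast
  then show ?thesis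
    by simp
qed

lemma free_int_cong: "ext_proj scale p = ext_proj scale q \<Longrightarrow> free_int p = free_int q"
  using free_int_ideal[of "p - q"] by (simp add: ext_proj_eq_iff free_int_diff)

text \<open>In a word of length \<open>n\<close> the letter passes \<open>n - 1\<close> others, an
  even number because \<open>n\<close> is odd. Words of any other length have integral 0 on both
  sides.\<close>

lemma free_int_rotate1: "free_int (W (a # w)) = free_int (W (w @ [a]))"
proof (cases "length (a # w) = n")
  case True
  then have "even (length w)"
    using odd_n by (metis even_Suc length_Cons)
  then show ?thesis
    using free_int_cong[OF word_rotate1[of scale w a]] by (simp add: free_int_scale)
qed (simp add: free_int_single word_det_def)

text \<open>Exchanging \<open>u\<close> and \<open>v\<close> amounts to \<open>length u\<close>
  rotations by one letter.\<close>

lemma free_int_word_commute: "free_int (W (u @ v)) = free_int (W (v @ u))"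
proof (induction u arbitrary: v)
  case (Cons a u)
  have "free_int (W ((a # u) @ v)) = free_int (W (u @ (v @ [a])))"
    using free_int_rotate1[of a "u @ v"] by simp
  also have "\<dots> = free_int (W (v @ a # u))"
    using Cons.IH[of "v @ [a]"] by simp
  finally show ?case .
qed simp

lemma free_int_commute: "free_int (p * q) = free_int (q * p)"
proof (induction p rule: free_algebra_induct)
  case (word u)
  show ?case
  proof (induction q rule: free_algebra_induct)
    case (word v)
    show ?case
      using free_int_word_commute[of u v] by (simp add: single_word_mult)
  qed (simp_all add: distrib_left distrib_right free_int_add free_scalar_left_commute
      free_int_scale mult.assoc)
qed (simp_all add: distrib_left distrib_right free_int_add free_scalar_left_commute free_int_scale
    mult.assoc)

text \<open>The product is a rearrangement of the word \<open>xs\<close>, whose integral is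
  1.\<close>

lemma free_int_monom_complement:
  assumes "T \<subseteq> set xs"
  shows "free_int (monom T * monom (set xs - T)) \<in> {1, -1}"
proof -
  let ?w = "filter (\<lambda>x. x \<in> T) xs @ filter (\<lambda>x. x \<in> set xs - T) xs"
  have "filter (\<lambda>x. x \<in> set xs - T) xs = filter (\<lambda>x. x \<notin> T) xs"
    by (rule filter_cong) auto
  then have "mset ?w = mset xs"
    by (simp flip: multiset_partition)
  then obtain s where s: "s \<in> {1, -1}" "ext_proj scale (W ?w)
      = ext_proj scale (free_scalar s * W xs)"
    using word_mset by blast
  then have "free_int (W ?w) = s"
    using free_int_cong[OF s(2)] by (simp add: free_int_scale free_int_single word_det_basis)
  then show ?thesis
    using s(1) by (simp add: monom_def single_word_mult)
qed

text \<open>Disjoint \<open>T\<close> and \<open>U\<close> that are not complementary give a word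
  that is too short; otherwise a letter is repeated.\<close>

lemma free_int_monom_not_complement:
  assumes "T \<subseteq> set xs" "U \<subseteq> set xs" "U \<noteq> set xs - T"
  shows "free_int (monom T * monom U) = 0"
proof (cases "T \<inter> U = {}")
  case True
  let ?w = "filter (\<lambda>x. x \<in> T) xs @ filter (\<lambda>x. x \<in> U) xs"
  have "distinct ?w" "set ?w = T \<union> U"
    using distinct_xs True assms by auto
  moreover have "T \<union> U \<subset> set xs"
    using assms True by auto
  ultimately have "length ?w < length xs"
    using distinct_xs psubset_card_mono[of "set xs" "T \<union> U"]
        by (metis distinct_card List.finite_set)
  then show ?thesis
    by (simp add: monom_def single_word_mult free_int_single word_det_def)
next
  case False
  let ?w = "filter (\<lambda>x. x \<in> T) xs @ filter (\<lambda>x. x \<in> U) xs"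
  have "\<not> distinct ?w"
    using False assms by auto
  from free_int_cong[OF word_not_distinct[OF this]] show ?thesis
    by (simp add: monom_def single_word_mult free_int_zero)
qed

end

section \<open>The integral and a derivation of divergence one\<close>

lemma k_algebra_exterior_algebra: "k_algebra (exterior_algebra scale)"
proof (intro k_algebra.intro k_algebra_axioms.intro ring_exterior_algebra)
  fix a b c
  assume "a \<in> carrier (exterior_algebra scale)" "b \<in> carrier (exterior_algebra scale)"
  then obtain p q where "a = ext_proj scale p" "b = ext_proj scale q"
    by (auto simp: ext_carrier)
  then show "a \<otimes>\<^bsub>exterior_algebra scale\<^esub> (c \<odot>\<^bsub>exterior_algebra scale\<^esub> b)
      = c \<odot>\<^bsub>exterior_algebra scale\<^esub> (a \<otimes>\<^bsub>exterior_algebra scale\<^esub> b)"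
    by (simp add: ext_mult ext_smult free_scalar_left_commute[of p])
qed (auto simp: ext_carrier ext_add ext_mult ext_smult distrib_left distrib_right single_add
    free_scalar_mult mult.assoc[symmetric])

context ext_basis_odd
begin

abbreviation "A \<equiv> exterior_algebra scale"
abbreviation "\<pi> \<equiv> ext_proj scale"

sublocale ext: k_algebra A
  by (rule k_algebra_exterior_algebra)

section \<open>The trace on the exterior algebra and its Frobenius property\<close>

definition ext_int :: "('k, 'v) free_algebra set \<Rightarrow> 'k" where
  "ext_int = lift_proj_fun scale free_int"

lemma ext_int_proj: "ext_int (\<pi> p) = free_int p"
  unfolding ext_int_def by (rule lift_proj_fun_proj) (simp add: free_int_cong ext_proj_eq_iff)

lemma ext_int_linear: "ext_int \<in> linear_maps A ground_field"
proof -
  have "restrict ext_int (carrier A) \<in> linear_maps A ground_field"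
    by (rule ext.functionalI)
        (auto simp: ext_carrier ext_add ext_smult ext_int_proj free_int_add free_int_scale)
  then show ?thesis
    by (simp add: ext_int_def lift_proj_fun_def)
qed

lemma functional_proj_sum:
  assumes "f \<in> linear_maps A ground_field"
  shows "f (\<pi> (\<Sum>i\<in>S. free_scalar (c i) * g i)) = (\<Sum>i\<in>S. c i * f (\<pi> (g i)))"
proof (induction S rule: infinite_finite_induct)
  case (insert i S)
  then show ?case
    by (simp add: ext_add[symmetric] ext_smult[symmetric]
        ext.functional_add[OF assms] ext.functional_smult[OF assms])
qed (use ext.functional_zero[OF assms] in \<open>simp_all add: ext_zero\<close>)

lemma functional_eqI:
  assumes "f \<in> linear_maps A ground_field" "g \<in> linear_maps A ground_field"
    and "\<And>T. T \<subseteq> set xs \<Longrightarrow> f (\<pi> (monom T)) = g (\<pi> (monom T))"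
  shows "f = g"
proof (rule ext.linear_maps_eqI[OF assms(1,2)])
  fix a assume "a \<in> carrier A"
  then obtain p where p: "a = \<pi> p"
    by (auto simp: ext_carrier)
  obtain c where "\<pi> p = \<pi> (\<Sum>T\<in>Pow (set xs). free_scalar (c T) * monom T)"
    using spanned_all[of p] by (auto simp: spanned_def)
  then show "f a = g a"
    using assms(3)
        by (simp add: p functional_proj_sum[OF assms(1)] functional_proj_sum[OF assms(2)])
qed

text \<open>Uniqueness holds because the monomials span: every monomial except the full one lies in
  an exterior power below \<open>n\<close>, and the full one is the wedge of
  \<open>xs\<close>.\<close>

lemma ext_integral_eq: "ext_integral scale xs = ext_int"
  unfolding ext_integral_def
proof (rule the_equality)
  have "ext_int a = 0" if "i < n" "a \<in> ext_power scale i" for i a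
  proof -
    obtain p where p: "a = \<pi> p" "\<forall>w\<in>Poly_Mapping.keys p. length (letters w) = i"
      using \<open>a \<in> ext_power scale i\<close> by (auto simp: ext_power_def)
    then have "free_int p = 0"
      using \<open>i < n\<close> by (auto simp: free_int_def lin_ext_def word_det_def intro!: sum.neutral)
    then show ?thesis
      by (simp add: p ext_int_proj)
  qed
  then show "ext_int \<in> linear_maps A ground_field \<and> (\<forall>i<n. \<forall>a\<in>ext_power scale i. ext_int a = 0) \<and>
      ext_int (wedge scale xs) = 1"
    by (simp add: ext_int_linear wedge_eq ext_int_proj free_int_single word_det_basis)
  then have ext_int: "\<forall>i<n. \<forall>a\<in>ext_power scale i. ext_int a = 0" "ext_int (wedge scale xs) = 1"
    by blast+
  fix f assume f: "f \<in> linear_maps A ground_field \<and> (\<forall>i<n. \<forall>a\<in>ext_power scale i. f a = 0) \<and>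
      f (wedge scale xs) = 1"
  show "f = ext_int"
  proof (rule functional_eqI)
    fix T assume T: "T \<subseteq> set xs"
    let ?w = "filter (\<lambda>x. x \<in> T) xs"
    show "f (\<pi> (monom T)) = ext_int (\<pi> (monom T))"
    proof (cases "T = set xs")
      case True
      then have "\<pi> (monom T) = wedge scale xs"
        by (simp add: wedge_eq monom_def)
      then show ?thesis
        using f ext_int by simp
    next
      case False
      then obtain x where "x \<in> set xs" "x \<notin> T"
        using T by blast
      then have "length ?w < n"
        by (rule length_filter_less)
      moreover have "\<pi> (monom T) \<in> ext_power scale (length ?w)"
        by (auto simp: ext_power_def monom_def)
      ultimately show ?thesis
        using f ext_int by simp
    qed
  qed (use f ext_int_linear in auto)
qed

text \<open>Pairing with the monomial of the complement of \<open>U\<close> extracts the coefficient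
  of \<open>monom U\<close> up to sign.\<close>

lemma ext_int_nondegenerate:
  assumes "a \<in> carrier A" and "\<And>b. b \<in> carrier A \<Longrightarrow> ext_int (b \<otimes>\<^bsub>A\<^esub> a) = 0"
  shows "a = \<zero>\<^bsub>A\<^esub>"
proof -
  obtain p where p: "a = \<pi> p"
    using assms(1) by (auto simp: ext_carrier)
  obtain c where c: "\<pi> p = \<pi> (\<Sum>T\<in>Pow (set xs). free_scalar (c T) * monom T)"
    using spanned_all[of p] by (auto simp: spanned_def)
  have "c U = 0" if U: "U \<subseteq> set xs" for U
  proof -
    let ?V = "set xs - U"
    have UV: "set xs - ?V = U"
      using U by blast
    have "ext_int (\<pi> (monom ?V) \<otimes>\<^bsub>A\<^esub> a) = 0"
      by (rule assms) simp
    then have "0 = free_int (monom ?V * (\<Sum>T\<in>Pow (set xs). free_scalar (c T) * monom T))"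
      by (simp add: p c ext_mult ext_int_proj)
    also have "\<dots> = (\<Sum>T\<in>Pow (set xs). c T * free_int (monom ?V * monom T))"
      by (simp add: sum_distrib_left free_scalar_left_commute free_int_sum free_int_scale)
    also have "\<dots> = (\<Sum>T\<in>Pow (set xs). if T = U then c U * free_int (monom ?V * monom U) else 0)"
    proof (intro sum.cong refl)
      fix T assume "T \<in> Pow (set xs)"
      then show "c T * free_int (monom ?V * monom T) = (if T
          = U then c U * free_int (monom ?V * monom U) else 0)"
        using free_int_monom_not_complement[of ?V T] UV by auto
    qed
    also have "\<dots> = c U * free_int (monom ?V * monom U)"
      using U by (simp add: sum.delta)
    finally show ?thesis
      using free_int_monom_complement[of ?V] UV by auto
  qed
  then have "(\<Sum>T\<in>Pow (set xs). free_scalar (c T) * monom T) = 0"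
    by (intro sum.neutral) auto
  then show ?thesis
    using c by (simp add: p ext_zero)
qed

text \<open>Signed complementary monomials form a dual family for the pairing, so the representing
  element is written down explicitly.\<close>

lemma ext_int_representable:
  assumes "\<phi> \<in> linear_maps A ground_field"
  shows "\<exists>d\<in>carrier A. \<forall>b\<in>carrier A. \<phi> b = ext_int (b \<otimes>\<^bsub>A\<^esub> d)"
proof -
  \<comment> \<open>This sign is 1 or -1, hence its own inverse: as a factor in the coefficients of
    \<open>d\<close> it cancels the sign arising from the pairing.\<close>
  let ?e = "\<lambda>T. free_int (monom T * monom (set xs - T))"
  define d where
    "d = (\<Sum>T\<in>Pow (set xs). free_scalar (\<phi> (\<pi> (monom T)) * ?e T) * monom (set xs - T))"
  have \<phi>: "\<phi> = (\<lambda>b\<in>carrier A. ext_int (b \<otimes>\<^bsub>A\<^esub> \<pi> d))"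
  proof (rule functional_eqI[OF assms])
    show "(\<lambda>b\<in>carrier A. ext_int (b \<otimes>\<^bsub>A\<^esub> \<pi> d)) \<in> linear_maps A ground_field"
      by (rule ext.functionalI)
        (auto simp: ext.l_distr ext.mult_smult_left
          ext.functional_add[OF ext_int_linear] ext.functional_smult[OF ext_int_linear])
    fix S assume S: "S \<subseteq> set xs"
    have "free_int (monom S * d)
        = (\<Sum>T\<in>Pow (set xs). \<phi> (\<pi> (monom T)) * ?e T * free_int (monom S * monom (set xs - T)))"
      by (simp add: d_def sum_distrib_left free_scalar_left_commute free_int_sum free_int_scale)
    also have "\<dots> = (\<Sum>T\<in>Pow (set xs). if T = S then \<phi> (\<pi> (monom S)) * ?e S * ?e S else 0)"
    proof (intro sum.cong refl)
      fix T assume T: "T \<in> Pow (set xs)"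
      show "\<phi> (\<pi> (monom T)) * ?e T * free_int (monom S * monom (set xs - T))
          = (if T = S then \<phi> (\<pi> (monom S)) * ?e S * ?e S else 0)"
      proof (cases "T = S")
        case False
        then have "set xs - T \<noteq> set xs - S"
          using S T by blast
        then have "free_int (monom S * monom (set xs - T)) = 0"
          using S by (intro free_int_monom_not_complement) auto
        then show ?thesis
          using False by simp
      qed simp
    qed
    also have "\<dots> = \<phi> (\<pi> (monom S))"
      using S free_int_monom_complement[OF S] by (auto simp: sum.delta)
    finally show "\<phi> (\<pi> (monom S)) = (\<lambda>b\<in>carrier A. ext_int (b \<otimes>\<^bsub>A\<^esub> \<pi> d)) (\<pi> (monom S))"
      by (simp add: ext_mult ext_int_proj)
  qed
  have "\<phi> b = ext_int (b \<otimes>\<^bsub>A\<^esub> \<pi> d)" if "b \<in> carrier A" for b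
    using fun_cong[OF \<phi>, of b] that by simp
  then show ?thesis
    by (intro bexI[of _ "\<pi> d"]) simp_all
qed

sublocale frob: symmetric_frobenius_algebra A ext_int
proof
  show "ext_int (a \<otimes>\<^bsub>A\<^esub> b) = ext_int (b \<otimes>\<^bsub>A\<^esub> a)" if "a \<in> carrier A" "b \<in> carrier A" for a b
    using that by (auto simp: ext_carrier ext_mult ext_int_proj free_int_commute)
qed (fact ext_int_linear ext_int_nondegenerate ext_int_representable)+

section \<open>The derivation extending the projection of \<open>V\<close> onto the line of
  \<open>hd xs\<close>\<close>

primrec word_deriv :: "'v list \<Rightarrow> ('k, 'v) free_algebra" where
  "word_deriv [] = 0"
| "word_deriv (v # w)
    = Poly_Mapping.single (Word [hd xs]) (coord (hd xs) v) * W w + free_gen v * word_deriv w"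

definition free_deriv :: "('k, 'v) free_algebra \<Rightarrow> ('k, 'v) free_algebra" where
  "free_deriv = lin_ext (\<lambda>c p. free_scalar c * p) word_deriv"

lemma free_deriv_add: "free_deriv (p + q) = free_deriv p + free_deriv q"
  and free_deriv_scale: "free_deriv (free_scalar c * p) = free_scalar c * free_deriv p"
  and free_deriv_single: "free_deriv (Poly_Mapping.single (Word w) c)
      = free_scalar c * word_deriv w"
  unfolding free_deriv_def
  by (rule vector_space.lin_ext_add[OF vector_space_free_algebra]
      vector_space.lin_ext_scale[OF vector_space_free_algebra]
      vector_space.lin_ext_single[OF vector_space_free_algebra])+

lemma free_deriv_zero: "free_deriv 0 = 0"
  using free_deriv_scale[of 0 0] by simp

lemma free_deriv_diff: "free_deriv (p - q) = free_deriv p - free_deriv q"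
  using free_deriv_add[of "p - q" q] by simp

lemma word_deriv_append: "word_deriv (u @ v) = word_deriv u * W v + W u * word_deriv v"
proof (induction u)
  case Nil
  show ?case
    using single_one by (simp add: zero_free_monoid_def[symmetric])
next
  case (Cons a u)
  have "W (u @ v) = W u * W v" "W (a # u) = free_gen a * W u"
    by (simp_all add: single_word_mult)
  then show ?case
    by (simp add: Cons.IH distrib_left distrib_right mult.assoc)
qed

lemma free_deriv_mult: "free_deriv (p * q) = free_deriv p * q + p * free_deriv q"
proof (induction p rule: free_algebra_induct)
  case (word u)
  show ?case
  proof (induction q rule: free_algebra_induct)
    case (word v)
    show ?case
      by (simp add: single_word_mult free_deriv_single word_deriv_append)
  next
    case (scale c q)
    then show ?case
      by (simp add: free_scalar_left_commute[of "W u"] free_scalar_left_commute[of "free_deriv (W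
          u)"]
          free_deriv_scale distrib_left)
  qed (simp add: distrib_left free_deriv_add algebra_simps)
next
  case (scale c p)
  then show ?case
    by (simp add: mult.assoc free_deriv_scale distrib_left)
qed (simp add: distrib_right free_deriv_add algebra_simps)

lemma free_deriv_gen: "free_deriv (free_gen v) = free_scalar (coord (hd xs) v) * free_gen (hd xs)"
  by (simp add: free_deriv_single single_word_mult scalar_single)

text \<open>The linear relations are sent to 0 because the coordinate is linear; a square
  \<open>v v\<close> is sent to a multiple of \<open>x v + v x\<close> with
  \<open>x = hd xs\<close>, which lies in the ideal by anticommutativity.\<close>

lemma free_deriv_relation:
  assumes "r \<in> ext_relations scale"
  shows "free_deriv r \<in> ext_ideal scale"
proof -
  consider v v' where "r = free_gen (v + v') - (free_gen v + free_gen v')"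
    | c v where "r = free_gen (scale c v) - free_scalar c * free_gen v"
    | v where "r = free_gen v * free_gen v"
    using assms by (auto simp: ext_relations_def)
  then show ?thesis
  proof cases
    case 1
    then have "free_deriv r = 0"
      by (simp add: free_deriv_diff free_deriv_add free_deriv_gen coord_add single_add
          distrib_right)
    then show ?thesis by (simp add: ext_ideal_zero)
  next
    case 2
    then have "free_deriv r = 0"
      by (simp add: free_deriv_diff free_deriv_scale free_deriv_gen coord_scale
          free_scalar_mult[symmetric] mult.assoc)
    then show ?thesis by (simp add: ext_ideal_zero)
  next
    case 3
    let ?x = "free_gen (hd xs) :: ('k, 'v) free_algebra"
    have "free_deriv r = free_scalar (coord (hd xs) v) * (?x * free_gen v - - (free_gen v * ?x))"
      unfolding 3 free_deriv_mult free_deriv_gen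
          by (simp add: free_scalar_left_commute[of "free_gen v"] mult.assoc distrib_left)
    moreover have "?x * free_gen v - - (free_gen v * ?x) \<in> ext_ideal scale"
      using gen_anticommute[of scale "hd xs" v] by (simp only: ext_proj_eq_iff)
    ultimately show ?thesis
      by (simp only: ext_ideal_mult_left)
  qed
qed

lemma free_deriv_ideal:
  assumes "p \<in> ext_ideal scale"
  shows "free_deriv p \<in> ext_ideal scale"
proof -
  \<comment> \<open>Membership of \<open>p\<close> in the ideal is carried along because the
    derivative of \<open>a * p\<close> also contains the term
    \<open>free_deriv a * p\<close>.\<close>
  have "ext_ideal scale \<subseteq> {p \<in> ext_ideal scale. free_deriv p \<in> ext_ideal scale}"
    by (rule ext_ideal_minimal)
      (auto simp: ext_ideal_zero free_deriv_zero free_deriv_add free_deriv_mult free_deriv_relation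
        intro: ext_ideal_add ext_ideal_mult_left ext_ideal_mult_right ext_relation_in_ideal)
  then show ?thesis
    using assms by blast
qed

definition \<delta> :: "('k, 'v) free_algebra set \<Rightarrow> ('k, 'v) free_algebra set" where
  "\<delta> = lift_proj_fun scale (\<lambda>p. \<pi> (free_deriv p))"

lemma \<delta>_proj: "\<delta> (\<pi> p) = \<pi> (free_deriv p)"
  unfolding \<delta>_def
  by (rule lift_proj_fun_proj)
      (simp add: ext_proj_eq_iff free_deriv_diff[symmetric] free_deriv_ideal)

lemma \<delta>_in_Der: "\<delta> \<in> carrier (Der A)"
proof (rule ext.DerI)
  have "restrict \<delta> (carrier A) \<in> linear_maps A A"
    by (rule ext.endoI)
        (auto simp: ext_carrier ext_add ext_smult \<delta>_proj free_deriv_add free_deriv_scale)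
  then show "\<delta> \<in> linear_maps A A"
    by (simp add: \<delta>_def lift_proj_fun_def)
qed (auto simp: ext_carrier ext_add ext_mult \<delta>_proj free_deriv_mult)

lemma word_deriv_zero: "(\<And>b. b \<in> set w \<Longrightarrow> coord (hd xs) b = 0) \<Longrightarrow> word_deriv w = 0"
  by (induction w) auto

text \<open>Only the first letter contributes: it is fixed, while the coordinate along
  \<open>hd xs\<close> of every later letter is zero.\<close>

lemma free_deriv_top: "free_deriv (W xs) = W xs"
proof -
  \<comment> \<open>An odd length is nonzero, so \<open>hd xs\<close> really is the first basis
    vector.\<close>
  have xs: "xs = hd xs # tl xs"
    using odd_n by (cases xs) auto
  have "hd xs \<in> set xs" "hd xs \<notin> set (tl xs)" "set (tl xs) \<subseteq> set xs"
    using xs distinct_xs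
        by (metis list.set_intros(1), metis distinct.simps(2), metis set_subset_Cons)
  then have "word_deriv (tl xs) = 0" and "coord (hd xs) (hd xs) = 1"
    by (auto intro!: word_deriv_zero simp: coord_basis subset_iff)
  then have "word_deriv (hd xs # tl xs) = W (hd xs # tl xs)"
    by (simp add: single_word_mult)
  then have "word_deriv xs = W xs"
    using xs by simp
  then show ?thesis
    by (simp add: free_deriv_single)
qed

lemma free_int_long:
  assumes "length u > n"
  shows "free_int (Poly_Mapping.single (Word u) c * q) = 0"
proof (induction q rule: free_algebra_induct)
  case (word w)
  show ?case
    using assms by (simp add: single_word_mult free_int_single word_det_def)
qed (simp_all add: distrib_left free_int_add free_scalar_left_commute free_int_scale)

text \<open>The derivative of the empty word is zero, and in the derivative of a longer word both
  summands begin with a letter. After multiplication by the word \<open>xs\<close> the prefix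
  exceeds length \<open>n\<close>, where the integral vanishes.\<close>

lemma free_int_top_D: "free_int (W xs * free_deriv p) = 0"
proof (induction p rule: free_algebra_induct)
  case (word w)
  show ?case
  proof (cases w)
    case (Cons v w')
    have "free_int (W xs * word_deriv w)
        = free_int (Poly_Mapping.single (Word (xs @ [hd xs])) (coord (hd xs) v) * W w')
        + free_int (Poly_Mapping.single (Word (xs @ [v])) 1 * word_deriv w')"
      unfolding Cons by (simp add: distrib_left free_int_add mult.assoc[symmetric] single_word_mult)
    then show ?thesis
      by (simp add: free_deriv_single free_int_long)
  qed (simp add: free_deriv_single free_int_zero)
qed (simp_all add: distrib_left free_int_add free_deriv_add free_deriv_scale
    free_scalar_left_commute free_int_scale)

lemma div_\<delta>_not_coboundary:
  assumes "m \<in> carrier (alg_center A)"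
  shows "frob.dv \<delta> \<noteq> \<delta> m"
proof
  assume eq: "frob.dv \<delta> = \<delta> m"
  obtain p where p: "m = \<pi> p"
    using assms by (auto simp: alg_center_def ext_carrier)
  have "1 = ext_int (\<delta> (\<pi> (W xs)))"
    by (simp add: \<delta>_proj free_deriv_top ext_int_proj free_int_single word_det_basis)
  also have "\<dots> = ext_int (\<pi> (W xs) \<otimes>\<^bsub>A\<^esub> frob.dv \<delta>)"
    by (rule frob.tr_dv[OF \<delta>_in_Der]) simp
  also have "\<dots> = 0"
    by (simp add: eq p \<delta>_proj ext_mult ext_int_proj free_int_top_D)
  finally show False
    by simp
qed

end

theorem lemma49:
  fixes scale :: "'k::field \<Rightarrow> 'v::ab_group_add \<Rightarrow> 'v"
    and n :: nat and xs :: "'v list"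
  assumes "CHAR('k) \<noteq> 2"
    and "finite_dimensional_vector_space scale (set xs)"
    and "distinct xs" and "length xs = n" and "odd n"
  shows "let A = exterior_algebra scale;
             H1 = CE_H1 (HH1 A) (alg_center A) HH1_act;
             Div = Div_class A (ext_form scale xs)
         in Div \<in> carrier H1 \<and> Div \<noteq> \<zero>\<^bsub>H1\<^esub>"
proof -
  have two: "(2::'k) \<noteq> 0"
  proof
    assume "(2::'k) = 0"
    then have "CHAR('k) dvd 2"
      using of_nat_eq_0_iff_char_dvd[of 2, where 'a = 'k] by simp
    then have "CHAR('k) = 1"
      \<comment> \<open>The characteristic divides the prime 2 and differs from it, so it would be
        1, which is impossible in a field.\<close>
      using assms(1) by (metis prime_nat_iff two_is_prime_nat)
    then show False
      by simp
  qed
  interpret ext_basis_odd scale xs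
    using assms two
    by (simp add: ext_basis_odd_def ext_basis_def ext_basis_axioms_def ext_basis_odd_axioms_def)
  \<comment> \<open>Identifies the form in the statement, given by a definite description, with the
    trace form of the constructed Frobenius algebra.\<close>
  have form: "ext_form scale xs = frob.form"
    by (simp add: fun_eq_iff ext_form_def ext_integral_eq)
  show ?thesis
    unfolding Let_def form
    using frob.Div_class_in_H1 frob.Div_class_nonzero[OF \<delta>_in_Der div_\<delta>_not_coboundary] by blast
qed

end
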